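(* Let $M$ be the interior of a compact 3-manifold $N$, all of whose boundary components are incompressible tori or Klein bottles. Suppose that $M$ is irreducible, $\mathbf{P}^2$-irreducible and atoroidal, and that $M$ has an ideal triangulation $\Gamma$ with $k$ tetrahedra, equipped with a taut structure or a semi-angle structure. Then there is a non-empty $k$-dimensional space $\mathcal{A}$ of angle structures for $\Gamma$ if and only if there are no branched normal classes in $\Gamma$ which contain some quadrilaterals with angle sum $2\pi$ in the given taut or semi-angle structure and contain no quadrilaterals with angle sum $<2\pi$.
   Context: Manifolds are smooth. $M$ is irreducible if every embedded 2-sphere bounds a 3-ball, and $\mathbf{P}^2$-irreducible if it is irreducible and has no embedded 2-sided projective planes. A boundary component is incompressible if its inclusion is $\pi_1$-injective. $M$ is atoroidal if every $\pi_1$-injective map of a torus or Klein bottle into $M$ is homotopic to a map into a boundary component of $N$. An ideal triangulation $\Gamma$ of $M$ is a decomposition of $M$ into tetrahedra $\Delta_1,\dots,\Delta_k$ glued along faces and edges, with all vertices removed, such that the link of each missing vertex is a torus or Klein bottle. Faces and edges of a single tetrahedron may be identified with each other. Angle data: to each $\Delta_i$ assign three dihedral angles $\alpha_i,\beta_i,\gamma_i$, one for each pair of opposite edges (opposite edges have the same angle), with $\alpha_i+\beta_i+\gamma_i=\pi$, such that for every edge of $\Gamma$ the sum of all dihedral angles around the edge (counted with multiplicity) is $2\pi$. This is an angle structure if all angles are strictly positive; a semi-angle structure if all angles are non-negative; a taut structure if all angles are $0$ or $\pi$ (so each tetrahedron has one pair of opposite edges with angle $\pi$ and the other four edges have angle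 $0$). The space $\mathcal{A}$ of angle structures is the set of all angle structures on $\Gamma$, viewed as a subset of $\mathbf{R}^{3k}$. Normal classes: each tetrahedron has four normal triangle types (each cutting off one vertex) and three normal quadrilateral types (each separating one pair of opposite edges). A vector in $\mathbf{R}^{7k}$ records the number of normal disks of each type. The compatibility equations say that, for each normal arc type in each face of $\Gamma$, the number of triangles and quadrilaterals having this arc type in their boundary on one side of the face equals the corresponding number on the other side. A normal surface is formed by gluing finitely many normal disks along their boundary arcs; it may be embedded, immersed or branched, and its coordinate vector, a non-negative integer solution of the compatibility equations, is its normal class. A branched normal class is the normal class of a normal surface which is permitted to have branch points. The angle sum of a quadrilateral is the sum of the dihedral angles, in the given structure, at the four edges of the tetrahedron which it meets. If the two edges disjoint from the quadrilateral have dihedral angle $\gamma$, the angle sum is $2\pi-2\gamma$. In a taut structure, angle sum $2\pi$ means that the angles at the corners are $0,\pi,0,\pi$, and angle sum $<2\pi$ means that all four angles are $0$.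
   Formalization: "k-dimensional" is read as "of dimension at least k": the space of all angle structures, when non-empty, has dimension k plus the number of cusps (e.g. 2 for the Gieseking manifold, where k = 1), so exact dimension k would be false. *)

theory Defs
  imports "HOL-Analysis.Analysis"
begin

section \<open>Quotient spaces and model surfaces\<close>

text \<open>The quotient of a space by the equivalence relation that \<open>r\<close> generates; its points are the
  equivalence classes (within the space).\<close>

definition glue_class :: "'a topology \<Rightarrow> ('a \<Rightarrow> 'a \<Rightarrow> bool) \<Rightarrow> 'a \<Rightarrow> 'a set" where
  "glue_class X r x = {y \<in> topspace X. equivclp r x y}"

definition glue_space :: "'a topology \<Rightarrow> ('a \<Rightarrow> 'a \<Rightarrow> bool) \<Rightarrow> 'a set topology" where
  "glue_space X r = topology (\<lambda>U. U \<subseteq> glue_class X r ` topspace X \<and>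
      openin X {x \<in> topspace X. glue_class X r x \<in> U})"

lemma openin_glue_space:
  "openin (glue_space X r) U \<longleftrightarrow> U \<subseteq> glue_class X r ` topspace X \<and>
      openin X {x \<in> topspace X. glue_class X r x \<in> U}"
proof -
  let ?c = "glue_class X r"
  let ?P = "\<lambda>U. U \<subseteq> ?c ` topspace X \<and> openin X {x \<in> topspace X. ?c x \<in> U}"
  have "?P (S \<inter> T)" if "?P S" "?P T" for S T
  proof -
    have "{x \<in> topspace X. ?c x \<in> S \<inter> T} = {x \<in> topspace X. ?c x \<in> S} \<inter> {x \<in> topspace X. ?c x \<in> T}"
      by auto
    then show ?thesis using that by (auto intro: openin_Int)
  qed
  moreover have "?P (\<Union>K)" if "\<forall>S\<in>K. ?P S" for K
  proof -
    have "{x \<in> topspace X. ?c x \<in> \<Union>K} = (\<Union>S\<in>K. {x \<in> topspace X. ?c x \<in> S})"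
      by auto
    then show ?thesis using that by (auto intro: openin_Union)
  qed
  ultimately have "istopology ?P"
    unfolding istopology_def by blast
  then show ?thesis
    by (simp add: glue_space_def)
qed

lemma quotient_map_glue_space: "quotient_map X (glue_space X r) (glue_class X r)"
proof -
  have "topspace (glue_space X r) = glue_class X r ` topspace X"
  proof
    show "topspace (glue_space X r) \<subseteq> glue_class X r ` topspace X"
      using openin_glue_space[of X r "topspace (glue_space X r)"] by simp
    have "{x \<in> topspace X. glue_class X r x \<in> glue_class X r ` topspace X} = topspace X"
      by auto
    then have "openin (glue_space X r) (glue_class X r ` topspace X)"
      by (simp add: openin_glue_space)
    then show "glue_class X r ` topspace X \<subseteq> topspace (glue_space X r)"
      by (rule openin_subset)
  qed
  then show ?thesis
    by (auto simp: quotient_map_def openin_glue_space)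
qed

definition unit_square :: "(real \<times> real) topology" where
  "unit_square = top_of_set ({0..1} \<times> {0..1})"

definition torus :: "(real \<times> real) set topology" where
  "torus = glue_space unit_square
     (\<lambda>(a, b) (c, d). (a = 0 \<and> c = 1 \<and> d = b) \<or> (b = 0 \<and> d = 1 \<and> c = a))"

definition klein_bottle :: "(real \<times> real) set topology" where
  "klein_bottle = glue_space unit_square
     (\<lambda>(a, b) (c, d). (a = 0 \<and> c = 1 \<and> d = 1 - b) \<or> (b = 0 \<and> d = 1 \<and> c = a))"

definition two_sphere :: "(real ^ 3) topology" where
  "two_sphere = top_of_set (sphere 0 1)"

definition projective_plane :: "(real ^ 3) set topology" where
  "projective_plane = glue_space two_sphere (\<lambda>x y. y = - x)"

definition torus_or_klein_bottle :: "'a topology \<Rightarrow> bool" where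
  "torus_or_klein_bottle F \<longleftrightarrow> F homeomorphic_space torus \<or> F homeomorphic_space klein_bottle"

section \<open>Smooth 3-manifolds with boundary\<close>

primrec Ck_on :: "nat \<Rightarrow> ('v::real_normed_vector \<Rightarrow> 'w::real_normed_vector) \<Rightarrow> 'v set \<Rightarrow> bool" where
  "Ck_on 0 f W \<longleftrightarrow> continuous_on W f"
| "Ck_on (Suc n) f W \<longleftrightarrow> (\<forall>x\<in>W. f differentiable (at x)) \<and>
      (\<forall>v. Ck_on n (\<lambda>x. frechet_derivative f (at x) v) W)"

text \<open>On a set that need not be open (an open subset of the half-space), smooth means: locally
  the restriction of a \<open>C\<^sup>\<infinity>\<close> map defined on an open set.\<close>

definition smooth_on :: "'v::real_normed_vector set \<Rightarrow> ('v \<Rightarrow> 'w::real_normed_vector) \<Rightarrow> bool" where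
  "smooth_on S f \<longleftrightarrow> (\<forall>x\<in>S. \<exists>W g. open W \<and> x \<in> W \<and> (\<forall>n. Ck_on n g W) \<and> (\<forall>y\<in>S \<inter> W. g y = f y))"

type_synonym 'a chart = "'a set \<times> ('a \<Rightarrow> real ^ 3)"

definition half_space :: "(real ^ 3) set" where
  "half_space = {x. 0 \<le> x $ 1}"

definition smooth_compatible :: "'a chart \<Rightarrow> 'a chart \<Rightarrow> bool" where
  "smooth_compatible = (\<lambda>(U, \<phi>) (V, \<psi>).
      smooth_on (\<phi> ` (U \<inter> V)) (\<psi> \<circ> inv_into U \<phi>) \<and>
      smooth_on (\<psi> ` (U \<inter> V)) (\<phi> \<circ> inv_into V \<psi>))"

definition homeo_chart :: "'a topology \<Rightarrow> 'a chart \<Rightarrow> bool" where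
  "homeo_chart N = (\<lambda>(U, \<phi>). openin N U \<and>
      homeomorphic_map (subtopology N U) (top_of_set (\<phi> ` U)) \<phi>)"

definition smooth_3manifold_with_boundary :: "'a topology \<Rightarrow> 'a chart set \<Rightarrow> bool" where
  "smooth_3manifold_with_boundary N \<C> \<longleftrightarrow>
      Hausdorff_space N \<and> second_countable N \<and>
      (\<Union>(U, \<phi>)\<in>\<C>. U) = topspace N \<and>
      (\<forall>(U, \<phi>)\<in>\<C>. homeo_chart N (U, \<phi>) \<and> openin (top_of_set half_space) (\<phi> ` U)) \<and>
      (\<forall>c\<in>\<C>. \<forall>d\<in>\<C>. smooth_compatible c d)"

definition bdry :: "'a topology \<Rightarrow> 'a chart set \<Rightarrow> 'a set" where
  "bdry N \<C> = {p \<in> topspace N. \<exists>(U, \<phi>)\<in>\<C>. p \<in> U \<and> \<phi> p $ 1 = 0}"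

definition int_set :: "'a topology \<Rightarrow> 'a chart set \<Rightarrow> 'a set" where
  "int_set N \<C> = topspace N - bdry N \<C>"

definition int_space :: "'a topology \<Rightarrow> 'a chart set \<Rightarrow> 'a topology" where
  "int_space N \<C> = subtopology N (int_set N \<C>)"

definition boundary_components :: "'a topology \<Rightarrow> 'a chart set \<Rightarrow> 'a set set" where
  "boundary_components N \<C> = connected_components_of (subtopology N (bdry N \<C>))"

text \<open>All smooth coordinate charts of the interior (its maximal atlas), with images open in
  \<open>\<real>\<^sup>3\<close>.\<close>

definition int_charts :: "'a topology \<Rightarrow> 'a chart set \<Rightarrow> 'a chart set" where
  "int_charts N \<C> = {(U, \<phi>). U \<subseteq> int_set N \<C> \<and> homeo_chart N (U, \<phi>) \<and> open (\<phi> ` U) \<and>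
      (\<forall>c\<in>\<C>. smooth_compatible (U, \<phi>) c)}"

section \<open>Irreducibility and \<open>P\<^sup>2\<close>-irreducibility of the interior\<close>

definition smooth_surface_in_interior :: "'a topology \<Rightarrow> 'a chart set \<Rightarrow> 'a set \<Rightarrow> bool" where
  "smooth_surface_in_interior N \<C> S \<longleftrightarrow> S \<subseteq> int_set N \<C> \<and>
      (\<forall>p\<in>S. \<exists>(U, \<phi>)\<in>int_charts N \<C>. p \<in> U \<and> \<phi> ` (U \<inter> S) = {x \<in> \<phi> ` U. x $ 1 = 0})"

text \<open>A smoothly embedded closed ball in the interior extends over a slightly larger open ball, so
  it is the closed unit ball of a smooth chart.\<close>

definition bounds_3ball :: "'a topology \<Rightarrow> 'a chart set \<Rightarrow> 'a set \<Rightarrow> bool" where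
  "bounds_3ball N \<C> S \<longleftrightarrow> (\<exists>(U, \<phi>)\<in>int_charts N \<C>. cball 0 1 \<subseteq> \<phi> ` U \<and>
      S = {p \<in> U. \<phi> p \<in> sphere 0 1})"

definition irreducible_interior :: "'a topology \<Rightarrow> 'a chart set \<Rightarrow> bool" where
  "irreducible_interior N \<C> \<longleftrightarrow> (\<forall>S. smooth_surface_in_interior N \<C> S \<and>
      subtopology N S homeomorphic_space two_sphere \<longrightarrow> bounds_3ball N \<C> S)"

definition two_sided :: "'a topology \<Rightarrow> 'a chart set \<Rightarrow> 'a set \<Rightarrow> bool" where
  "two_sided N \<C> S \<longleftrightarrow> (\<exists>h :: 'a \<times> real \<Rightarrow> 'a.
      embedding_map (prod_topology (subtopology N S) (top_of_set {-1<..<1})) (int_space N \<C>) h \<and>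
      openin (int_space N \<C>) (h ` (S \<times> {-1<..<1})) \<and> (\<forall>p\<in>S. h (p, 0) = p))"

definition P2_irreducible_interior :: "'a topology \<Rightarrow> 'a chart set \<Rightarrow> bool" where
  "P2_irreducible_interior N \<C> \<longleftrightarrow> irreducible_interior N \<C> \<and>
      \<not> (\<exists>S. smooth_surface_in_interior N \<C> S \<and>
           subtopology N S homeomorphic_space projective_plane \<and> two_sided N \<C> S)"

section \<open>Incompressible boundary and atoroidality\<close>

definition path_homotopic :: "'a topology \<Rightarrow> (real \<Rightarrow> 'a) \<Rightarrow> (real \<Rightarrow> 'a) \<Rightarrow> bool" where
  "path_homotopic X p q \<longleftrightarrow>
      homotopic_with (\<lambda>r. r 0 = p 0 \<and> r 1 = p 1) (top_of_set {0..1}) X p q"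

text \<open>Injectivity of \<open>\<pi>\<^sub>1(X, x) \<rightarrow> \<pi>\<^sub>1(Y, f x)\<close> for every base point \<open>x\<close>.\<close>

definition pi1_injective :: "'a topology \<Rightarrow> 'b topology \<Rightarrow> ('a \<Rightarrow> 'b) \<Rightarrow> bool" where
  "pi1_injective X Y f \<longleftrightarrow> continuous_map X Y f \<and>
      (\<forall>x\<in>topspace X. \<forall>p q. pathin X p \<and> pathin X q \<and>
          p 0 = x \<and> p 1 = x \<and> q 0 = x \<and> q 1 = x \<and> path_homotopic Y (f \<circ> p) (f \<circ> q)
        \<longrightarrow> path_homotopic X p q)"

definition incompressible :: "'a topology \<Rightarrow> 'a set \<Rightarrow> bool" where
  "incompressible N F \<longleftrightarrow> pi1_injective (subtopology N F) N id"

definition atoroidal_interior :: "'a topology \<Rightarrow> 'a chart set \<Rightarrow> bool" where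
  "atoroidal_interior N \<C> \<longleftrightarrow> (\<forall>T\<in>{torus, klein_bottle}. \<forall>f. pi1_injective T (int_space N \<C>) f \<longrightarrow>
      (\<exists>F\<in>boundary_components N \<C>. \<exists>g. continuous_map T (subtopology N F) g \<and>
          homotopic_with (\<lambda>_. True) T N f g))"

section \<open>Ideal triangulations\<close>

text \<open>The tetrahedra are indexed by the finite type \<open>'k\<close>, the vertices of each tetrahedron by the
  type \<open>4\<close>, and face \<open>f\<close> is the face opposite vertex \<open>f\<close>. The value \<open>(t', \<sigma>)\<close> of a face pairing
  at \<open>(t, f)\<close> says that face \<open>f\<close> of \<open>t\<close> is glued to face \<open>\<sigma> f\<close> of \<open>t'\<close> by the affine map taking
  each vertex \<open>v \<noteq> f\<close> to the vertex \<open>\<sigma> v\<close>.\<close>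

type_synonym 'k face_pairing = "'k \<Rightarrow> 4 \<Rightarrow> 'k \<times> (4 \<Rightarrow> 4)"

definition vertex_step :: "'k face_pairing \<Rightarrow> 'k \<times> 4 \<Rightarrow> 'k \<times> 4 \<Rightarrow> bool" where
  "vertex_step \<Gamma> = (\<lambda>(t, v) (t', v'). \<exists>f \<sigma>. f \<noteq> v \<and> \<Gamma> t f = (t', \<sigma>) \<and> v' = \<sigma> v)"

text \<open>\<open>(t, i, j)\<close> with \<open>i \<noteq> j\<close> is the edge of \<open>t\<close> oriented from \<open>i\<close> to \<open>j\<close>.\<close>

definition edge_step :: "'k face_pairing \<Rightarrow> 'k \<times> 4 \<times> 4 \<Rightarrow> 'k \<times> 4 \<times> 4 \<Rightarrow> bool" where
  "edge_step \<Gamma> = (\<lambda>(t, i, j) (t', i', j').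
      \<exists>f \<sigma>. f \<noteq> i \<and> f \<noteq> j \<and> \<Gamma> t f = (t', \<sigma>) \<and> i' = \<sigma> i \<and> j' = \<sigma> j)"

definition point_step :: "'k face_pairing \<Rightarrow> 'k \<times> (real ^ 4) \<Rightarrow> 'k \<times> (real ^ 4) \<Rightarrow> bool" where
  "point_step \<Gamma> = (\<lambda>(t, x) (t', y). \<exists>f \<sigma>. x $ f = 0 \<and> \<Gamma> t f = (t', \<sigma>) \<and> (\<forall>v. y $ \<sigma> v = x $ v))"

text \<open>The last condition (no edge is glued to itself with reversed orientation) is necessary for
  the quotient to be a manifold at the midpoints of edges.\<close>

definition face_gluing :: "'k face_pairing \<Rightarrow> bool" where
  "face_gluing \<Gamma> \<longleftrightarrow>
      (\<forall>t f t' \<sigma>. \<Gamma> t f = (t', \<sigma>) \<longrightarrow>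
          bij \<sigma> \<and> (t', \<sigma> f) \<noteq> (t, f) \<and> \<Gamma> t' (\<sigma> f) = (t, inv \<sigma>)) \<and>
      (\<forall>t i j. i \<noteq> j \<longrightarrow> \<not> equivclp (edge_step \<Gamma>) (t, i, j) (t, j, i))"

definition ideal_simplex :: "(real ^ 4) set" where
  "ideal_simplex = {x. (\<forall>i. 0 \<le> x $ i \<and> x $ i \<noteq> 1) \<and> (\<Sum>i\<in>UNIV. x $ i) = 1}"

definition ideal_tetrahedra :: "('k \<times> (real ^ 4)) topology" where
  "ideal_tetrahedra = prod_topology (discrete_topology UNIV) (top_of_set ideal_simplex)"

definition triangulated_space :: "'k face_pairing \<Rightarrow> ('k \<times> (real ^ 4)) set topology" where
  "triangulated_space \<Gamma> = glue_space ideal_tetrahedra (point_step \<Gamma>)"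

text \<open>The link of the ideal vertex represented by vertex \<open>v\<close> of \<open>t\<close>: the triangles that cut off
  the identified tetrahedron vertices at barycentric height \<open>3/4\<close>, glued along their sides.\<close>

definition vertex_link :: "'k face_pairing \<Rightarrow> 'k \<Rightarrow> 4 \<Rightarrow> ('k \<times> (real ^ 4)) set topology" where
  "vertex_link \<Gamma> t v = glue_space
      (subtopology ideal_tetrahedra
        {(t', x). \<exists>v'. equivclp (vertex_step \<Gamma>) (t, v) (t', v') \<and> x $ v' = 3 / 4})
      (point_step \<Gamma>)"

definition ideal_triangulation :: "'k face_pairing \<Rightarrow> 'a topology \<Rightarrow> bool" where
  "ideal_triangulation \<Gamma> M \<longleftrightarrow> face_gluing \<Gamma> \<and>
      triangulated_space \<Gamma> homeomorphic_space M \<and>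
      (\<forall>t v. torus_or_klein_bottle (vertex_link \<Gamma> t v))"

section \<open>Angle data\<close>

text \<open>The three pairs of opposite edges of a tetrahedron are indexed by the type \<open>3\<close>; \<open>pair_type i j\<close>
  is the pair containing the edge with end points \<open>i \<noteq> j\<close>.\<close>

definition pair_type :: "4 \<Rightarrow> 4 \<Rightarrow> 3" where
  "pair_type i j =
     (if {i, j} = {0, 1} \<or> {i, j} = {2, 3} then 0
      else if {i, j} = {0, 2} \<or> {i, j} = {1, 3} then 1
      else 2)"

text \<open>\<open>\<theta> $ t $ q\<close> is the dihedral angle of tetrahedron \<open>t\<close> at the two edges in the pair \<open>q\<close>, so
  angle data live in a space of dimension \<open>3k\<close>.\<close>

type_synonym 'k angles = "real ^ 3 ^ 'k"

text \<open>No edge is glued to its reverse, so each edge of each tetrahedron has at most one orientation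
  in the class of \<open>(t, i, j)\<close>: the sum is over all dihedral angles around an edge, with
  multiplicity.\<close>

definition edge_angle_sum :: "'k::finite face_pairing \<Rightarrow> 'k angles \<Rightarrow> 'k \<Rightarrow> 4 \<Rightarrow> 4 \<Rightarrow> real" where
  "edge_angle_sum \<Gamma> \<theta> t i j =
     (\<Sum>(t', i', j')\<in>{e. equivclp (edge_step \<Gamma>) (t, i, j) e}. \<theta> $ t' $ pair_type i' j')"

definition angle_data :: "'k::finite face_pairing \<Rightarrow> 'k angles \<Rightarrow> bool" where
  "angle_data \<Gamma> \<theta> \<longleftrightarrow> (\<forall>t. (\<Sum>q\<in>UNIV. \<theta> $ t $ q) = pi) \<and>
      (\<forall>t i j. i \<noteq> j \<longrightarrow> edge_angle_sum \<Gamma> \<theta> t i j = 2 * pi)"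

definition angle_structure :: "'k::finite face_pairing \<Rightarrow> 'k angles \<Rightarrow> bool" where
  "angle_structure \<Gamma> \<theta> \<longleftrightarrow> angle_data \<Gamma> \<theta> \<and> (\<forall>t q. \<theta> $ t $ q > 0)"

definition semi_angle_structure :: "'k::finite face_pairing \<Rightarrow> 'k angles \<Rightarrow> bool" where
  "semi_angle_structure \<Gamma> \<theta> \<longleftrightarrow> angle_data \<Gamma> \<theta> \<and> (\<forall>t q. \<theta> $ t $ q \<ge> 0)"

definition taut_structure :: "'k::finite face_pairing \<Rightarrow> 'k angles \<Rightarrow> bool" where
  "taut_structure \<Gamma> \<theta> \<longleftrightarrow> angle_data \<Gamma> \<theta> \<and> (\<forall>t q. \<theta> $ t $ q \<in> {0, pi})"

definition angle_structure_space :: "'k::finite face_pairing \<Rightarrow> 'k angles set" where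
  "angle_structure_space \<Gamma> = {\<theta>. angle_structure \<Gamma> \<theta>}"

section \<open>Normal surfaces and branched normal classes\<close>

text \<open>\<open>Tri v\<close> cuts off vertex \<open>v\<close>; \<open>Quad q\<close> separates the two opposite edges in the pair \<open>q\<close>.\<close>

datatype normal_disk = Tri 4 | Quad 3

text \<open>\<open>has_arc \<delta> f v\<close>: the disk \<open>\<delta>\<close> meets face \<open>f\<close> in an arc that cuts off the vertex \<open>v\<close> of that
  face. A quadrilateral does so iff it separates the edge \<open>fv\<close> from the opposite edge.\<close>

fun has_arc :: "normal_disk \<Rightarrow> 4 \<Rightarrow> 4 \<Rightarrow> bool" where
  "has_arc (Tri w) f v \<longleftrightarrow> f \<noteq> w \<and> v = w"
| "has_arc (Quad q) f v \<longleftrightarrow> f \<noteq> v \<and> pair_type f v = q"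

text \<open>A normal surface: finitely many disks \<open>d \<in> D\<close>, where \<open>ty d\<close> is the tetrahedron and normal type
  of \<open>d\<close>, and a pairing \<open>g\<close> of all their boundary arcs. An arc is named by its disk and the face
  containing it, and is paired with an arc of the matching type on the other side of that face.
  Nothing is required around the edges of the triangulation, so branch points are permitted.\<close>

definition branched_normal_surface ::
  "'k face_pairing \<Rightarrow> nat set \<Rightarrow> (nat \<Rightarrow> 'k \<times> normal_disk) \<Rightarrow> (nat \<times> 4 \<Rightarrow> nat \<times> 4) \<Rightarrow> bool" where
  "branched_normal_surface \<Gamma> D ty g \<longleftrightarrow> finite D \<and>
      (\<forall>d\<in>D. \<forall>t \<delta> f v t' \<sigma>. ty d = (t, \<delta>) \<and> has_arc \<delta> f v \<and> \<Gamma> t f = (t', \<sigma>) \<longrightarrow>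
          (\<exists>d'\<in>D. \<exists>\<delta>'. g (d, f) = (d', \<sigma> f) \<and> g (d', \<sigma> f) = (d, f) \<and>
              ty d' = (t', \<delta>') \<and> has_arc \<delta>' (\<sigma> f) (\<sigma> v)))"

text \<open>Coordinate vectors, indexed by the \<open>7k\<close> normal disk types.\<close>

type_synonym 'k normal_vector = "'k \<Rightarrow> normal_disk \<Rightarrow> nat"

definition branched_normal_class :: "'k face_pairing \<Rightarrow> 'k normal_vector \<Rightarrow> bool" where
  "branched_normal_class \<Gamma> x \<longleftrightarrow> (\<exists>D ty g. branched_normal_surface \<Gamma> D ty g \<and>
      (\<forall>t \<delta>. x t \<delta> = card {d \<in> D. ty d = (t, \<delta>)}))"

text \<open>The sum of the angles at the four edges which the quadrilateral meets, i.e. those outside the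
  pair of edges that it separates.\<close>

definition quad_angle_sum :: "'k::finite angles \<Rightarrow> 'k \<Rightarrow> 3 \<Rightarrow> real" where
  "quad_angle_sum \<theta> t q = (\<Sum>(i, j)\<in>{(i, j). i < j \<and> pair_type i j \<noteq> q}. \<theta> $ t $ pair_type i j)"

end

theory Submission
  imports Defs
begin

text \<open>
  Quadrilaterals with angle sum \<open>2\<pi>\<close> are those of angle \<open>0\<close>, so a bad class is a solution of the
  compatibility equations whose quadrilaterals all have angle \<open>0\<close> and which has at least one
  quadrilateral. Branched normal classes are all non-negative integer solutions of the compatibility
  equations, and combinatorial Gauss--Bonnet makes the quadrilateral part of any solution orthogonal
  to the difference of two angle data, which excludes a bad class when an angle structure exists.

  Conversely, the tetrahedral and edge solutions have as quadrilateral parts the normals of the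
  equations that define angle data. By Stiemke's alternative, applied over the rationals so that it
  yields integral solutions, either some combination of them gives a bad class, or there is a tangent
  direction that is positive wherever the given angle is \<open>0\<close>; moving slightly in this direction gives
  an angle structure. There are \<open>k\<close> tetrahedra and, counting all dihedral angles in two ways, \<open>k\<close>
  edges, so angle structures form an open part of an affine space of dimension at least \<open>3k - 2k\<close>.
\<close>

section \<open>Theorems of the alternative\<close>

text \<open>Bartl's induction: if dropping \<open>a m\<close> destroys the implication, project everything along a
  counterexample \<open>x\<close> onto the kernel of \<open>a m\<close>.\<close>

lemma farkas:
  fixes a :: "'i \<Rightarrow> 'b \<Rightarrow> 'f::linordered_field"
  assumes "finite I" "finite B"
    and "\<And>y. (\<And>i. i \<in> I \<Longrightarrow> (\<Sum>b\<in>B. a i b * y b) \<le> 0) \<Longrightarrow> (\<Sum>b\<in>B. c b * y b) \<le> 0"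
  shows "\<exists>l. (\<forall>i\<in>I. 0 \<le> l i) \<and> (\<forall>b\<in>B. c b = (\<Sum>i\<in>I. l i * a i b))"
  using assms(1,3)
proof (induction I arbitrary: a c rule: finite_induct)
  case empty
  \<comment> \<open>With no rows the implication applies to \<open>y = c\<close>, which forces
    \<open>c\<close> to vanish on \<open>B\<close>.\<close>
  have "(\<Sum>b\<in>B. c b * c b) \<le> 0"
    using empty by blast
  then have "(\<Sum>b\<in>B. c b * c b) = 0"
    by (simp add: sum_nonneg order_antisym)
  then have "\<forall>b\<in>B. c b = 0"
    using \<open>finite B\<close> by (simp add: sum_nonneg_eq_0_iff)
  then show ?case by simp
next
  case (insert m I)
  define d :: "('b \<Rightarrow> 'f) \<Rightarrow> ('b \<Rightarrow> 'f) \<Rightarrow> 'f" where "d u y = (\<Sum>b\<in>B. u b * y b)" for u y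
  show ?case
  proof (cases "\<forall>y. (\<forall>i\<in>I. d (a i) y \<le> 0) \<longrightarrow> d c y \<le> 0")
    case True
    then obtain l where l: "\<forall>i\<in>I. 0 \<le> l i" "\<forall>b\<in>B. c b = (\<Sum>i\<in>I. l i * a i b)"
      using insert.IH[of a c] unfolding d_def by blast
    have "(\<Sum>i\<in>insert m I. (l(m := 0)) i * a i b) = (\<Sum>i\<in>I. l i * a i b)" for b
      using insert.hyps by (auto intro!: sum.cong)
    with l show ?thesis
      by (intro exI[of _ "l(m := 0)"]) auto
  next
    case False
    then obtain x where x: "\<forall>i\<in>I. d (a i) x \<le> 0" "d c x > 0"
      by (auto simp: not_le)
    \<comment> \<open>Otherwise \<open>x\<close> would satisfy the inequalities of the full family
      and still have \<open>d c x > 0\<close>.\<close>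
    have mx: "d (a m) x > 0"
      using insert.prems[of x] x unfolding d_def by force
    define r where "r u = d u x / d (a m) x" for u
    define P where "P u = (\<lambda>b. u b - r u * a m b)" for u
    have dP: "d (P u) y = d u y - r u * d (a m) y" for u y
      by (simp add: d_def P_def algebra_simps sum_subtractf sum_distrib_left)
    have shift: "d u (\<lambda>b. y b - s * x b) = d u y - s * d u x" for u y s
      by (simp add: d_def algebra_simps sum_subtractf sum_distrib_left)
    \<comment> \<open>\<open>P u\<close> is \<open>u\<close> composed with the projection along
      \<open>x\<close> onto the kernel of \<open>a m\<close>. On that kernel row \<open>m\<close>
      holds with equality, so only the rows in \<open>I\<close> remain to be checked.\<close>
    have P_shift: "d u (\<lambda>b. y b - d (a m) y / d (a m) x * x b) = d (P u) y" for u y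
      unfolding shift dP r_def by simp
    have "d (P c) y \<le> 0" if "\<And>i. i \<in> I \<Longrightarrow> d (P (a i)) y \<le> 0" for y
    proof -
      have "d (P (a m)) y = 0"
        using mx by (simp add: dP r_def)
      then show ?thesis
        using insert.prems[of "\<lambda>b. y b - d (a m) y / d (a m) x * x b"] that
        unfolding d_def[symmetric] P_shift by (metis insert_iff order_refl)
    qed
    then obtain l where l: "\<forall>i\<in>I. 0 \<le> l i" "\<forall>b\<in>B. P c b = (\<Sum>i\<in>I. l i * P (a i) b)"
      using insert.IH[of "\<lambda>i. P (a i)" "P c"] unfolding d_def by blast
    \<comment> \<open>Undoing the projection leaves a multiple of \<open>a m\<close>, and
      \<open>s\<close> is its coefficient.\<close>
    define s where "s = r c - (\<Sum>i\<in>I. l i * r (a i))"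
    have "(\<Sum>i\<in>I. l i * r (a i)) \<le> 0"
      using l(1) x(1) mx by (intro sum_nonpos mult_nonneg_nonpos) (auto simp: r_def divide_le_0_iff)
    moreover have "r c > 0"
      using x mx by (simp add: r_def)
    ultimately have "s \<ge> 0"
      by (simp add: s_def)
    moreover have "c b = (\<Sum>i\<in>insert m I. (l(m := s)) i * a i b)" if "b \<in> B" for b
    proof -
      have "(\<Sum>i\<in>I. (l(m := s)) i * a i b) = (\<Sum>i\<in>I. l i * a i b)"
        using insert.hyps by (auto intro!: sum.cong)
      moreover have "c b - r c * a m b = (\<Sum>i\<in>I. l i * a i b) - (\<Sum>i\<in>I. l i * r (a i)) * a m b"
        using bspec[OF l(2) that]
        by (simp add: P_def algebra_simps sum_subtractf sum_distrib_left sum_distrib_right)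
      ultimately show ?thesis
        using insert.hyps by (simp add: s_def algebra_simps)
    qed
    ultimately show ?thesis
      using l(1) by (intro exI[of _ "l(m := s)"]) auto
  qed
qed

text \<open>By \<open>no\<close>, the row \<open>a p\<close> is nonpositive on the cone where all
  rows are non-negative and those outside \<open>P\<close> vanish, so Farkas writes it in terms of
  the rows describing this cone. This gives a relation that is strict at one \<open>p\<close>;
  adding the relations over all \<open>p\<close> makes it strict on \<open>P\<close>.\<close>

lemma stiemke:
  fixes a :: "'i \<Rightarrow> 'b \<Rightarrow> 'f::linordered_field"
  assumes fin: "finite I" "finite B" and "P \<subseteq> I"
    and no: "\<And>y p. \<lbrakk>\<And>i. i \<in> I \<Longrightarrow> 0 \<le> (\<Sum>b\<in>B. a i b * y b);
        \<And>i. i \<in> I - P \<Longrightarrow> (\<Sum>b\<in>B. a i b * y b) = 0; p \<in> P\<rbrakk> \<Longrightarrow> (\<Sum>b\<in>B. a p b * y b) \<le> 0"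
  shows "\<exists>x. (\<forall>b\<in>B. (\<Sum>i\<in>I. x i * a i b) = 0) \<and> (\<forall>i\<in>P. 0 < x i)"
proof -
  have "\<exists>x. (\<forall>b\<in>B. (\<Sum>i\<in>I. x i * a i b) = 0) \<and> (\<forall>i\<in>P. 0 \<le> x i) \<and> 0 < x p" if "p \<in> P" for p
  proof -
    \<comment> \<open>\<open>Inl\<close> tags the inequalities for all of \<open>I\<close>,
      \<open>Inr\<close> the opposite inequalities outside \<open>P\<close>.\<close>
    define v where "v = case_sum (\<lambda>i b. - a i b) a"
    have v: "v (Inl i) = (\<lambda>b. - a i b)" "v (Inr i) = a i" for i
      by (simp_all add: v_def)
    have p: "p \<in> I" using that \<open>P \<subseteq> I\<close> by auto
    have "\<exists>l. (\<forall>i\<in>I <+> (I - P). 0 \<le> l i) \<and> (\<forall>b\<in>B. a p b = (\<Sum>i\<in>I <+> (I - P). l i * v i b))"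
    proof (rule farkas)
      fix y assume y: "\<And>i. i \<in> I <+> (I - P) \<Longrightarrow> (\<Sum>b\<in>B. v i b * y b) \<le> 0"
      have 1: "0 \<le> (\<Sum>b\<in>B. a i b * y b)" if "i \<in> I" for i
        using y[OF InlI[OF that]] by (simp add: v sum_negf)
      have "(\<Sum>b\<in>B. a i b * y b) = 0" if "i \<in> I - P" for i
        using y[OF InrI[OF that]] 1[of i] that by (simp add: v)
      with 1 show "(\<Sum>b\<in>B. a p b * y b) \<le> 0"
        using no \<open>p \<in> P\<close> by blast
    qed (use fin in auto)
    then obtain l where l: "\<forall>i\<in>I <+> (I - P). 0 \<le> l i"
        "\<forall>b\<in>B. a p b = (\<Sum>i\<in>I <+> (I - P). l i * v i b)"
      by blast
    \<comment> \<open>These are the coefficients once all terms are moved to the side of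
      \<open>a p\<close>. On \<open>P\<close> there is no row tagged \<open>Inr\<close>, hence the
      default 0.\<close>
    define x where "x i = of_bool (i = p) + l (Inl i) - (if i \<in> P then 0 else l (Inr i))" for i
    have "(\<Sum>i\<in>I. x i * a i b) = 0" if "b \<in> B" for b
    proof -
      have "(\<Sum>i\<in>I. x i * a i b) = a p b + (\<Sum>i\<in>I. l (Inl i) * a i b) -
          (\<Sum>i\<in>I. if i \<in> P then 0 else l (Inr i) * a i b)"
        using p fin
        by (simp add: x_def distrib_right left_diff_distrib sum.distrib sum_subtractf
            if_distrib[of "\<lambda>x. x * _"] cong: if_cong)
      also have "(\<Sum>i\<in>I. if i \<in> P then 0 else l (Inr i) * a i b) = (\<Sum>i\<in>I-P. l (Inr i) * a i b)"
        using fin by (intro sum.mono_neutral_cong_right) auto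
      finally show ?thesis
        using l(2) that fin by (simp add: sum.Plus v sum_negf)
    qed
    moreover have "0 \<le> x i" if "i \<in> P" for i
      using that l(1) \<open>P \<subseteq> I\<close> by (auto simp: x_def intro!: add_nonneg_nonneg)
    moreover have "0 < x p"
      using l(1) p \<open>p \<in> P\<close> by (simp add: x_def add_pos_nonneg InlI)
    ultimately show ?thesis by blast
  qed
  then obtain X where X: "\<And>p b. p \<in> P \<Longrightarrow> b \<in> B \<Longrightarrow> (\<Sum>i\<in>I. X p i * a i b) = 0"
      "\<And>p i. p \<in> P \<Longrightarrow> i \<in> P \<Longrightarrow> 0 \<le> X p i" "\<And>p. p \<in> P \<Longrightarrow> 0 < X p p"
    by metis
  have "finite P" using fin \<open>P \<subseteq> I\<close> finite_subset by blast
  show ?thesis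
  proof (intro exI[of _ "\<lambda>i. \<Sum>p\<in>P. X p i"] conjI ballI)
    fix b assume "b \<in> B"
    have "(\<Sum>i\<in>I. (\<Sum>p\<in>P. X p i) * a i b) = (\<Sum>p\<in>P. \<Sum>i\<in>I. X p i * a i b)"
      by (simp add: sum_distrib_right sum.swap[of _ P])
    then show "(\<Sum>i\<in>I. (\<Sum>p\<in>P. X p i) * a i b) = 0"
      using X(1) \<open>b \<in> B\<close> by simp
  next
    fix i assume "i \<in> P"
    then show "0 < (\<Sum>p\<in>P. X p i)"
      using X(2,3) \<open>finite P\<close> by (intro sum_pos2[of P i]) auto
  qed
qed

section \<open>Clearing denominators\<close>

lemma common_denominator:
  fixes A :: "rat set"
  assumes "finite A"
  shows "\<exists>N::nat. 0 < N \<and> (\<forall>a\<in>A. of_nat N * a \<in> \<int>)"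
  using assms
proof (induction A rule: finite_induct)
  case empty
  then show ?case by (intro exI[of _ 1]) simp
next
  case (insert a A)
  then obtain N :: nat where N: "0 < N" "\<forall>a\<in>A. of_nat N * a \<in> \<int>"
    by blast
  obtain p q where pq: "quotient_of a = (p, q)" by fastforce
  have q: "q > 0" using pq by (rule quotient_of_denom_pos)
  have a: "a = of_int p / of_int q" using pq by (rule quotient_of_div)
  have "of_nat (N * nat q) * b \<in> \<int>" if "b \<in> insert a A" for b
  proof (cases "b = a")
    case True
    have "of_nat (N * nat q) * a = of_nat N * of_int p"
      using q by (simp add: a)
    then show ?thesis using True by (metis Ints_mult Ints_of_int Ints_of_nat)
  next
    case False
    then have "of_int q * (of_nat N * b) \<in> \<int>"
      using N that Ints_mult[OF Ints_of_int[of q], of "of_nat N * b"] by auto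
    moreover have "of_nat (N * nat q) * b = of_int q * (of_nat N * b)"
      using q by (simp add: of_nat_nat mult_ac)
    ultimately show ?thesis by metis
  qed
  then show ?case
    using N q by (intro exI[of _ "N * nat q"]) auto
qed

section \<open>Edges of a tetrahedron\<close>

text \<open>\<open>UNIV_4\<close> and \<open>forall_4\<close> enumerate up to the numeral 4, while
  \<open>pair_type\<close> uses the names 0 to 3; the same holds for type \<open>3\<close>.\<close>

lemma four_eq_zero: "(4::4) = 0" by simp

lemma three_eq_zero: "(3::3) = 0" by simp

lemma UNIV_tetrahedron: "UNIV = {0, 1, 2, 3::4}"
  unfolding UNIV_4 four_eq_zero by auto

lemma all_4: "(\<forall>i::4. P i) \<longleftrightarrow> P 0 \<and> P 1 \<and> P 2 \<and> P 3"
  unfolding forall_4 four_eq_zero by auto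

lemma UNIV_pairs: "UNIV = {0, 1, 2::3}"
  unfolding UNIV_3 three_eq_zero by auto

lemma all_3: "(\<forall>i::3. P i) \<longleftrightarrow> P 0 \<and> P 1 \<and> P 2"
  unfolding forall_3 three_eq_zero by auto

lemma pair_type_commute: "pair_type i j = pair_type j i"
  by (simp add: pair_type_def insert_commute)

text \<open>Opposite edges are disjoint, whereas any two sides of the triangle \<open>i\<close>,
  \<open>j\<close>, \<open>f\<close> meet.\<close>

lemma pair_types_at_vertex:
  assumes "i \<noteq> j" "f \<noteq> i" "f \<noteq> j"
  shows "UNIV = {pair_type i j, pair_type f i, pair_type f j}"
    "pair_type f i \<noteq> pair_type i j" "pair_type f j \<noteq> pair_type i j" "pair_type f i \<noteq> pair_type f j"
proof -
  have "\<forall>i j f::4. i \<noteq> j \<and> f \<noteq> i \<and> f \<noteq> j \<longrightarrow> pair_type f i \<noteq> pair_type i j \<and>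
    pair_type f j \<noteq> pair_type i j \<and> pair_type f i \<noteq> pair_type f j \<and> 
    (\<forall>q. q = pair_type i j \<or> q = pair_type f i \<or> q = pair_type f j)"
    unfolding all_4 all_3 by (simp add: pair_type_def doubleton_eq_iff)
  then show  "UNIV = {pair_type i j, pair_type f i, pair_type f j}"
    "pair_type f i \<noteq> pair_type i j" "pair_type f j \<noteq> pair_type i j" "pair_type f i \<noteq> pair_type f j"
    using assms by auto
qed

text \<open>The left side is what an edge \<open>ij\<close> contributes to the arcs of an edge
  solution that cut off \<open>v\<close> in face \<open>f\<close>. Only edges lying in the face
  contribute, and the sign depends on nothing but the face, so both adjacent tetrahedra see the same
  number.\<close>

lemma pair_type_face:
  assumes "i \<noteq> j" "f \<noteq> v"
  shows "of_bool (pair_type i j = pair_type f v) - of_bool (v = i \<or> v = j) =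
    (if i \<noteq> f \<and> j \<noteq> f then if v = i \<or> v = j then - 1 else 1 else 0 :: 'a::ring_1)"
proof -
  have "\<forall>i j f v::4. i \<noteq> j \<and> f \<noteq> v \<longrightarrow> of_bool (pair_type i j = pair_type f v) - of_bool (v = i \<or> v = j) =
    (if i \<noteq> f \<and> j \<noteq> f then if v = i \<or> v = j then - 1 else 1 else 0 :: 'a)"
    unfolding all_4 by (simp add: pair_type_def doubleton_eq_iff)
  with assms show ?thesis by blast
qed

text \<open>Each pair consists of two edges, and each edge has two orientations.\<close>

lemma sum_pair_type:
  fixes h :: "3 \<Rightarrow> real"
  shows "(\<Sum>(i, j)\<in>{(i, j). i \<noteq> j}. h (pair_type i j)) = 4 * (\<Sum>q\<in>UNIV. h q)"
proof -
  have "(\<Sum>(i, j)\<in>{(i, j). i \<noteq> j}. h (pair_type i j)) =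
      (\<Sum>(i, j)\<in>UNIV. if i = j then 0 else h (pair_type i j))"
    by (intro sum.mono_neutral_cong_left) auto
  also have "\<dots> = (\<Sum>i\<in>UNIV. \<Sum>j\<in>UNIV. if i = j then 0 else h (pair_type i j))"
    by (simp add: sum.cartesian_product flip: UNIV_Times_UNIV)
  also have "\<dots> = 4 * (\<Sum>q\<in>UNIV. h q)"
    unfolding UNIV_tetrahedron UNIV_pairs
    by (simp add: pair_type_def doubleton_eq_iff algebra_simps)
  finally show ?thesis .
qed

lemma quad_angle_sum_eq: "quad_angle_sum \<theta> t q = 2 * (\<Sum>p\<in>UNIV. \<theta> $ t $ p) - 2 * \<theta> $ t $ q"
proof -
  define h where "h p = (if p = q then 0 else \<theta> $ t $ p)" for p
  have less: "quad_angle_sum \<theta> t q = (\<Sum>(i, j)\<in>{(i, j). i < j}. h (pair_type i j))"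
    unfolding quad_angle_sum_def h_def by (intro sum.mono_neutral_cong_left) auto
  \<comment> \<open>The order only selects one orientation of each edge; adding the other one makes
    \<open>sum_pair_type\<close> applicable.\<close>
  also have "\<dots> = (\<Sum>(i, j)\<in>{(i, j). j < i}. h (pair_type i j))"
    by (rule sum.reindex_bij_witness[of _ prod.swap prod.swap]) (auto simp: pair_type_commute)
  finally have "2 * quad_angle_sum \<theta> t q =
      (\<Sum>(i, j)\<in>{(i, j). i < j}. h (pair_type i j)) + (\<Sum>(i, j)\<in>{(i, j). j < i}. h (pair_type i j))"
    using less by simp
  also have "\<dots> = (\<Sum>(i, j)\<in>{(i, j). i \<noteq> j}. h (pair_type i j))"
    by (subst sum.union_disjoint[symmetric]) (auto intro!: sum.cong)
  also have "\<dots> = 4 * ((\<Sum>p\<in>UNIV. \<theta> $ t $ p) - \<theta> $ t $ q)"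
    by (subst sum_pair_type) (simp add: h_def sum.remove[of UNIV q])
  finally show ?thesis by (simp add: algebra_simps)
qed

section \<open>Branched normal classes and compatibility\<close>

lemma has_arc_unique: "has_arc \<delta> f v \<Longrightarrow> has_arc \<delta> f w \<Longrightarrow> v = w"
  using pair_types_at_vertex(4)[of v w f] by (cases \<delta>) auto

lemma has_arc_neq: "has_arc \<delta> f v \<Longrightarrow> v \<noteq> f"
  by (cases \<delta>) auto

lemma has_arc_iff: "v \<noteq> f \<Longrightarrow> has_arc \<delta> f v \<longleftrightarrow> \<delta> = Tri v \<or> \<delta> = Quad (pair_type f v)"
  by (cases \<delta>) auto

lemma face_gluingD:
  assumes "face_gluing \<Gamma>" "\<Gamma> t f = (t', \<sigma>)"
  shows "bij \<sigma>" "\<Gamma> t' (\<sigma> f) = (t, inv \<sigma>)"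
  using assms unfolding face_gluing_def by blast+

text \<open>The value type is left open because solutions occur over \<open>nat\<close> (normal
  classes), \<open>rat\<close> (the alternative) and \<open>real\<close> (Gauss-Bonnet).\<close>

definition arcs :: "('k \<Rightarrow> normal_disk \<Rightarrow> 'n::semiring_1) \<Rightarrow> 'k \<Rightarrow> 4 \<Rightarrow> 4 \<Rightarrow> 'n" where
  "arcs x t f v = x t (Tri v) + x t (Quad (pair_type f v))"

definition compatible :: "'k face_pairing \<Rightarrow> ('k \<Rightarrow> normal_disk \<Rightarrow> 'n::semiring_1) \<Rightarrow> bool" where
  "compatible \<Gamma> x \<longleftrightarrow>
     (\<forall>t f v t' \<sigma>. \<Gamma> t f = (t', \<sigma>) \<and> v \<noteq> f \<longrightarrow> arcs x t f v = arcs x t' (\<sigma> f) (\<sigma> v))"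

lemma compatibleD:
  "compatible \<Gamma> x \<Longrightarrow> \<Gamma> t f = (t', \<sigma>) \<Longrightarrow> v \<noteq> f \<Longrightarrow> arcs x t f v = arcs x t' (\<sigma> f) (\<sigma> v)"
  by (simp add: compatible_def)

definition arc_disks :: "nat set \<Rightarrow> (nat \<Rightarrow> 'k \<times> normal_disk) \<Rightarrow> 'k \<Rightarrow> 4 \<Rightarrow> 4 \<Rightarrow> nat set" where
  "arc_disks D ty t f v = {d \<in> D. fst (ty d) = t \<and> has_arc (snd (ty d)) f v}"

lemma card_arc_disks:
  assumes "finite D" "v \<noteq> f"
  shows "card (arc_disks D ty t f v) = arcs (\<lambda>t \<delta>. card {d \<in> D. ty d = (t, \<delta>)}) t f v"
proof -
  have "arc_disks D ty t f v =
      {d \<in> D. ty d = (t, Tri v)} \<union> {d \<in> D. ty d = (t, Quad (pair_type f v))}"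
    using assms by (auto simp: arc_disks_def has_arc_iff prod_eq_iff)
  then show ?thesis
    unfolding arcs_def using assms by (simp add: card_Un_disjoint disjoint_iff)
qed

text \<open>Crossing a face by \<open>g\<close> maps the arcs of one type injectively to those of
  the matching type, since \<open>g\<close> also leads back. The inverse gluing gives the other
  inequality.\<close>

lemma branched_normal_class_compatible:
  assumes "face_gluing \<Gamma>" "branched_normal_class \<Gamma> x"
  shows "compatible \<Gamma> x"
proof -
  obtain D ty g where surface: "branched_normal_surface \<Gamma> D ty g"
    and x: "x = (\<lambda>t \<delta>. card {d \<in> D. ty d = (t, \<delta>)})"
    using assms(2) unfolding branched_normal_class_def fun_eq_iff by blast
  have fin: "finite D"
    using surface by (simp add: branched_normal_surface_def)
  have g: "\<exists>d'\<in>D. \<exists>\<delta>'. g (d, f) = (d', \<sigma> f) \<and> g (d', \<sigma> f) = (d, f) \<and>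
              ty d' = (t', \<delta>') \<and> has_arc \<delta>' (\<sigma> f) (\<sigma> v)"
    if "d \<in> D" "ty d = (t, \<delta>)" "has_arc \<delta> f v" "\<Gamma> t f = (t', \<sigma>)" for d t \<delta> f v t' \<sigma>
    using surface that unfolding branched_normal_surface_def by blast
  have le: "card (arc_disks D ty t f v) \<le> card (arc_disks D ty t' (\<sigma> f) (\<sigma> v))"
    if \<Gamma>: "\<Gamma> t f = (t', \<sigma>)" for t f v t' \<sigma>
  proof (rule card_inj_on_le[of "\<lambda>d. fst (g (d, f))"])
    have *: "g (d, f) = (fst (g (d, f)), \<sigma> f) \<and> g (fst (g (d, f)), \<sigma> f) = (d, f) \<and>
        fst (g (d, f)) \<in> arc_disks D ty t' (\<sigma> f) (\<sigma> v)" if "d \<in> arc_disks D ty t f v" for d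
      using g[of d t "snd (ty d)" f v t' \<sigma>] that \<Gamma> by (fastforce simp: arc_disks_def prod_eq_iff)
    show "inj_on (\<lambda>d. fst (g (d, f))) (arc_disks D ty t f v)"
      by (rule inj_onI) (metis * fst_conv)
    show "(\<lambda>d. fst (g (d, f))) ` arc_disks D ty t f v \<subseteq> arc_disks D ty t' (\<sigma> f) (\<sigma> v)"
      using * by blast
    show "finite (arc_disks D ty t' (\<sigma> f) (\<sigma> v))"
      using fin by (simp add: arc_disks_def)
  qed
  show ?thesis
    unfolding compatible_def
  proof (intro allI impI, elim conjE)
    fix t f v t' \<sigma> assume \<Gamma>: "\<Gamma> t f = (t', \<sigma>)" and "v \<noteq> f"
    note \<sigma> = face_gluingD[OF assms(1) \<Gamma>]
    have inj: "inj \<sigma>" using \<sigma>(1) by (rule bij_is_inj)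
    then have "card (arc_disks D ty t' (\<sigma> f) (\<sigma> v)) \<le> card (arc_disks D ty t f v)"
      using le[OF \<sigma>(2), of "\<sigma> v"] by simp
    with le[OF \<Gamma>, of v] have "card (arc_disks D ty t f v) = card (arc_disks D ty t' (\<sigma> f) (\<sigma> v))"
      by simp
    then show "arcs x t f v = arcs x t' (\<sigma> f) (\<sigma> v)"
      using \<open>v \<noteq> f\<close> inj fin by (simp add: card_arc_disks x inj_eq)
  qed
qed

lemma finite_normal_disk [simp]: "finite (UNIV :: normal_disk set)"
proof -
  have "(UNIV :: normal_disk set) = range Tri \<union> range Quad"
    by (auto intro: normal_disk.exhaust)
  then show ?thesis by (metis finite_UnI finite_imageI finite)
qed

text \<open>Compatibility says that matching arc types are equally numerous on the two sides of a
  face, so the arcs can be paired off arbitrarily; nothing has to be checked around edges.\<close>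

lemma compatible_branched_normal_class:
  fixes \<Gamma> :: "'k::finite face_pairing"
  assumes "face_gluing \<Gamma>" "compatible \<Gamma> x"
  shows "branched_normal_class \<Gamma> x"
proof -
  \<comment> \<open>\<open>Z\<close> holds \<open>x t \<delta>\<close> labelled copies of each disk
    type; \<open>h\<close> numbers them, as the disks of a surface are natural numbers.\<close>
  define Z where "Z = (SIGMA s:UNIV. {..<x (fst s) (snd s)})"
  have "finite (UNIV :: ('k \<times> normal_disk) set)"
    by (simp add: finite_prod)
  then have "finite Z"
    unfolding Z_def by (rule finite_SigmaI) simp
  then obtain h where h: "bij_betw h {0..<card Z} Z"
    using ex_bij_betw_nat_finite by blast
  define D where "D = {0..<card Z}"
  define ty where "ty = fst \<circ> h"
  have x: "x = (\<lambda>t \<delta>. card {d \<in> D. ty d = (t, \<delta>)})"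
  proof (intro ext)
    fix t \<delta>
    have "h ` {d \<in> D. ty d = (t, \<delta>)} = {z \<in> h ` D. fst z = (t, \<delta>)}"
      unfolding ty_def comp_def by blast
    moreover have "h ` D = Z" "inj_on h {d \<in> D. ty d = (t, \<delta>)}"
      using h unfolding D_def bij_betw_def by (auto intro: inj_on_subset)
    ultimately have "bij_betw h {d \<in> D. ty d = (t, \<delta>)} {z \<in> Z. fst z = (t, \<delta>)}"
      by (simp add: bij_betw_def)
    then have "card {d \<in> D. ty d = (t, \<delta>)} = card {z \<in> Z. fst z = (t, \<delta>)}"
      by (rule bij_betw_same_card)
    also have "{z \<in> Z. fst z = (t, \<delta>)} = {(t, \<delta>)} \<times> {..<x t \<delta>}"
      by (auto simp: Z_def)
    finally show "x t \<delta> = card {d \<in> D. ty d = (t, \<delta>)}"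
      by (simp add: card_cartesian_product)
  qed
  have fin: "finite D" by (simp add: D_def)
  \<comment> \<open>One enumeration per set of disks is fixed, so that crossing a face back uses the
    same ranks and undoes the first crossing.\<close>
  define E where "E S = (SOME h. bij_betw h {0..<card S} S)" for S :: "nat set"
  have E: "bij_betw (E S) {0..<card S} S" if "finite S" for S
    unfolding E_def using ex_bij_betw_nat_finite[OF that] by (rule someI_ex)
  define rank where "rank S = inv_into {0..<card S} (E S)" for S
  have rank: "rank S d < card S" "E S (rank S d) = d" if "d \<in> S" "finite S" for d S
    using E[OF that(2)] that(1) unfolding rank_def
    by (metis bij_betw_imp_surj_on inv_into_into atLeastLessThan_iff, metis bij_betw_inv_into_right)
  have rank_E: "rank S (E S m) = m" "E S m \<in> S" if "m < card S" "finite S" for m S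
    using E[OF that(2)] that(1) unfolding rank_def
    by (simp add: bij_betw_inv_into_left, meson atLeastLessThan_iff bij_betwE le0)
  define S where "S = arc_disks D ty"
  have finS: "finite (S t f v)" for t f v
    using fin by (simp add: S_def arc_disks_def)
  \<comment> \<open>Each arc goes to the arc of equal rank across the face. A disk has at most one
    arc in a face, so \<open>THE\<close> recovers the vertex that is cut off.\<close>
  define g where "g = (\<lambda>(d, f). let t = fst (ty d); v = (THE v. has_arc (snd (ty d)) f v);
      t' = fst (\<Gamma> t f); \<sigma> = snd (\<Gamma> t f)
    in (E (S t' (\<sigma> f) (\<sigma> v)) (rank (S t f v) d), \<sigma> f))"
  have g: "g (d, f) = (E (S t' (\<sigma> f) (\<sigma> v)) (rank (S t f v) d), \<sigma> f)"
    if "d \<in> S t f v" "\<Gamma> t f = (t', \<sigma>)" for d f t' \<sigma> t v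
  proof -
    have "(THE v. has_arc (snd (ty d)) f v) = v"
      using that by (intro the_equality) (auto simp: S_def arc_disks_def dest: has_arc_unique)
    moreover have "fst (ty d) = t" using that by (simp add: S_def arc_disks_def)
    ultimately show ?thesis using that by (simp add: g_def)
  qed
  have "\<exists>d'\<in>D. \<exists>\<delta>'. g (d, f) = (d', \<sigma> f) \<and> g (d', \<sigma> f) = (d, f) \<and>
              ty d' = (t', \<delta>') \<and> has_arc \<delta>' (\<sigma> f) (\<sigma> v)"
    if "d \<in> D" "ty d = (t, \<delta>)" "has_arc \<delta> f v" and \<Gamma>: "\<Gamma> t f = (t', \<sigma>)" for d t \<delta> f v t' \<sigma>
  proof -
    let ?S = "S t f v" and ?S' = "S t' (\<sigma> f) (\<sigma> v)"
    note \<sigma> = face_gluingD[OF assms(1) \<Gamma>]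
    have inj: "inj \<sigma>" using \<sigma>(1) by (rule bij_is_inj)
    have vf: "v \<noteq> f" using that(3) by (rule has_arc_neq)
    have dS: "d \<in> ?S" using that by (simp add: S_def arc_disks_def)
    have "card ?S = card ?S'"
      using compatibleD[OF assms(2) \<Gamma> vf] vf inj fin
      unfolding S_def by (simp add: card_arc_disks x[symmetric] inj_eq)
    then have m: "rank ?S d < card ?S'"
      using rank(1)[OF dS finS] by simp
    define d' where "d' = E ?S' (rank ?S d)"
    have d': "d' \<in> ?S'" "rank ?S' d' = rank ?S d"
      unfolding d'_def using rank_E[OF m finS] by auto
    have "g (d', \<sigma> f) = (E ?S (rank ?S d), f)"
      using g[OF d'(1) \<sigma>(2)] d'(2) inj by simp
    then have "g (d', \<sigma> f) = (d, f)"
      using rank(2)[OF dS finS] by simp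
    moreover have "g (d, f) = (d', \<sigma> f)"
      using g[OF dS \<Gamma>] by (simp add: d'_def)
    ultimately show ?thesis
      using d'(1) by (intro bexI[of _ d'] exI[of _ "snd (ty d')"]) (auto simp: S_def arc_disks_def)
  qed
  then have "branched_normal_surface \<Gamma> D ty g"
    using fin unfolding branched_normal_surface_def by blast
  then show ?thesis
    unfolding branched_normal_class_def using x by metis
qed

section \<open>Edge classes\<close>

abbreviation edges :: "('k \<times> 4 \<times> 4) set" where
  "edges \<equiv> {(t, i, j). i \<noteq> j}"

definition edge_class :: "'k face_pairing \<Rightarrow> 'k \<times> 4 \<times> 4 \<Rightarrow> ('k \<times> 4 \<times> 4) set" where
  "edge_class \<Gamma> e = {e'. equivclp (edge_step \<Gamma>) e e'}"

lemma edge_class_step: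
  assumes "\<Gamma> t f = (t', \<sigma>)" "f \<noteq> i" "f \<noteq> j"
  shows "(t, i, j) \<in> edge_class \<Gamma> e \<longleftrightarrow> (t', \<sigma> i, \<sigma> j) \<in> edge_class \<Gamma> e"
proof -
  have "edge_step \<Gamma> (t, i, j) (t', \<sigma> i, \<sigma> j)"
    using assms by (auto simp: edge_step_def)
  then show ?thesis
    unfolding edge_class_def by (auto intro: equivclp_into_equivclp)
qed

text \<open>Invariance under single gluings propagates along the class. It serves for distinctness
  of end points, for edge weights and for reversal of orientation.\<close>

lemma edge_class_invariant:
  assumes "e' \<in> edge_class \<Gamma> e"
    and "\<And>t f t' \<sigma> i j. \<Gamma> t f = (t', \<sigma>) \<Longrightarrow> f \<noteq> i \<Longrightarrow> f \<noteq> j \<Longrightarrow> P (t, i, j) = P (t', \<sigma> i, \<sigma> j)"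
  shows "P e' = P e"
proof -
  have step: "P y = P z" if "edge_step \<Gamma> y z" for y z
    using that assms(2) by (fastforce simp: edge_step_def split: prod.splits)
  have "equivclp (edge_step \<Gamma>) e e'"
    using assms(1) by (simp add: edge_class_def)
  then show ?thesis
    by (induction rule: equivclp_induct) (auto dest: step)
qed

lemma edge_class_edges:
  assumes "face_gluing \<Gamma>" "e \<in> edges" "e' \<in> edge_class \<Gamma> e"
  shows "e' \<in> edges"
proof -
  have "(e' \<in> edges) = (e \<in> edges)"
    by (rule edge_class_invariant[OF assms(3)])
      (simp add: inj_eq bij_is_inj face_gluingD(1)[OF assms(1)])
  with assms show ?thesis by simp
qed

lemma edge_class_eqI: "e' \<in> edge_class \<Gamma> e \<Longrightarrow> edge_class \<Gamma> e' = edge_class \<Gamma> e"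
  unfolding edge_class_def by (auto intro: equivclp_trans equivclp_sym)

lemma edge_class_refl: "e \<in> edge_class \<Gamma> e"
  by (simp add: edge_class_def)

lemma sum_edge_classes:
  fixes h :: "'k::finite \<times> 4 \<times> 4 \<Rightarrow> 'n::comm_monoid_add"
  assumes "face_gluing \<Gamma>"
  shows "(\<Sum>e\<in>edges. h e) = (\<Sum>c\<in>edge_class \<Gamma> ` edges. \<Sum>e\<in>c. h e)"
proof -
  have "{e' \<in> edges. edge_class \<Gamma> e' = c} = c" if c: "c \<in> edge_class \<Gamma> ` edges" for c
  proof -
    obtain e where e: "e \<in> edges" "c = edge_class \<Gamma> e" using c by (rule imageE)
    show ?thesis
    proof
      show "{e' \<in> edges. edge_class \<Gamma> e' = c} \<subseteq> c"
        using edge_class_refl by (metis (lifting) mem_Collect_eq subsetI)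
      show "c \<subseteq> {e' \<in> edges. edge_class \<Gamma> e' = c}"
        using edge_class_edges[OF assms e(1)] edge_class_eqI[of _ \<Gamma> e] unfolding e(2)
        by (intro subsetI CollectI conjI; simp)
    qed
  qed
  then have "(\<Sum>c\<in>edge_class \<Gamma> ` edges. \<Sum>e\<in>{e' \<in> edges. edge_class \<Gamma> e' = c}. h e) =
      (\<Sum>c\<in>edge_class \<Gamma> ` edges. \<Sum>e\<in>c. h e)"
    by (intro sum.cong) auto
  then show ?thesis
    using sum.image_gen[of edges h "edge_class \<Gamma>"] by simp
qed

lemma sum_edges_tetrahedra:
  fixes h :: "'k::finite \<Rightarrow> 4 \<Rightarrow> 4 \<Rightarrow> 'n::comm_monoid_add"
  shows "(\<Sum>(t, i, j)\<in>edges. h t i j) = (\<Sum>t\<in>UNIV. \<Sum>(i, j)\<in>{(i, j). i \<noteq> j}. h t i j)"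
proof -
  have "(edges :: ('k \<times> 4 \<times> 4) set) = UNIV \<times> {(i, j). i \<noteq> j}" by auto
  then show ?thesis by (simp add: sum.cartesian_product)
qed

section \<open>The tetrahedral and edge solutions\<close>

text \<open>In each face of \<open>s\<close> every arc type lies on one triangle type and one
  quadrilateral type, so the signs cancel all arcs.\<close>

fun tet_solution :: "'k \<Rightarrow> 'k \<Rightarrow> normal_disk \<Rightarrow> 'n::ring_1" where
  "tet_solution s t (Quad q) = of_bool (s = t)"
| "tet_solution s t (Tri v) = - of_bool (s = t)"

text \<open>Each tetrahedron corner around the edge contributes the quadrilateral disjoint from the
  edge, minus the triangles at its two ends. Pairing the quadrilateral part with angles gives the
  angle sum around the edge.\<close>

fun edge_solution :: "'k face_pairing \<Rightarrow> 'k \<times> 4 \<times> 4 \<Rightarrow> 'k \<Rightarrow> normal_disk \<Rightarrow> 'n::ring_1" where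
  "edge_solution \<Gamma> e t (Quad q) =
     (\<Sum>(s, i, j)\<in>edge_class \<Gamma> e. of_bool (s = t \<and> pair_type i j = q))"
| "edge_solution \<Gamma> e t (Tri v) =
     - (\<Sum>(s, i, j)\<in>edge_class \<Gamma> e. of_bool (s = t \<and> (v = i \<or> v = j)))"

lemma compatible_tet_solution: "compatible \<Gamma> (tet_solution s)"
  by (simp add: compatible_def arcs_def)

lemma compatible_edge_solution:
  fixes \<Gamma> :: "'k::finite face_pairing"
  assumes "face_gluing \<Gamma>" "e \<in> edges"
  shows "compatible \<Gamma> (edge_solution \<Gamma> e :: _ \<Rightarrow> _ \<Rightarrow> 'n::ring_1)"
  unfolding compatible_def
proof (intro allI impI, elim conjE)
  \<comment> \<open>\<open>F t f\<close> collects the members of the class that lie in face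
    \<open>f\<close> of \<open>t\<close>. The gluing map carries it bijectively to the other side
    and preserves the signs \<open>?s\<close>.\<close>
  define F where "F t f = {(i, j). (t, i, j) \<in> edge_class \<Gamma> e \<and> i \<noteq> f \<and> j \<noteq> f}" for t f
  let ?s = "\<lambda>v (i, j). if v = i \<or> v = j then - 1 else 1 :: 'n"
  have arcs: "arcs (edge_solution \<Gamma> e) t f v = sum (?s v) (F t f)" if "v \<noteq> f" for t f v
  proof -
    have "arcs (edge_solution \<Gamma> e) t f v = (\<Sum>(s, i, j)\<in>edge_class \<Gamma> e.
        of_bool (s = t \<and> pair_type i j = pair_type f v) - of_bool (s = t \<and> (v = i \<or> v = j)) :: 'n)"
      by (simp add: arcs_def sum_subtractf case_prod_unfold)
    also have "\<dots> = (\<Sum>(s, i, j)\<in>edge_class \<Gamma> e.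
        if s = t \<and> i \<noteq> f \<and> j \<noteq> f then ?s v (i, j) else 0)"
    proof -
      have "of_bool (s = t \<and> pair_type i j = pair_type f v) - of_bool (s = t \<and> (v = i \<or> v = j)) =
          (if s = t \<and> i \<noteq> f \<and> j \<noteq> f then ?s v (i, j) else 0)"
        if "(s, i, j) \<in> edge_class \<Gamma> e" for s i j
        using pair_type_face[of i j f v, where 'a='n] \<open>v \<noteq> f\<close> edge_class_edges[OF assms that] by auto
      then show ?thesis
        by (intro sum.cong refl) (simp only: split_paired_all prod.case)
    qed
    also have "\<dots> = (\<Sum>(s, i, j)\<in>{t} \<times> F t f. ?s v (i, j))"
      by (rule sum.mono_neutral_cong_right) (auto simp: F_def split: if_splits)
    also have "\<dots> = sum (?s v) (F t f)"
      by (subst sum.cartesian_product[symmetric]) simp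
    finally show ?thesis .
  qed
  fix t f v t' \<sigma> assume \<Gamma>: "\<Gamma> t f = (t', \<sigma>)" and "v \<noteq> f"
  note \<sigma> = face_gluingD[OF assms(1) \<Gamma>]
  have inj: "inj \<sigma>" using \<sigma>(1) by (rule bij_is_inj)
  have surj: "\<sigma> (inv \<sigma> i) = i" for i using \<sigma>(1) by (simp add: bij_is_surj surj_f_inv_f)
  note step = edge_class_step[where \<Gamma> = \<Gamma> and t = t and f = f and t' = t' and \<sigma> = \<sigma>, OF \<Gamma>]
  have F: "map_prod \<sigma> \<sigma> ` F t f = F t' (\<sigma> f)"
  proof
    show "map_prod \<sigma> \<sigma> ` F t f \<subseteq> F t' (\<sigma> f)"
      using step[of _ _ e] inj by (auto simp: F_def inj_eq)
    show "F t' (\<sigma> f) \<subseteq> map_prod \<sigma> \<sigma> ` F t f"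
    proof clarify
      fix i j assume ij: "(i, j) \<in> F t' (\<sigma> f)"
      then have "f \<noteq> inv \<sigma> i" "f \<noteq> inv \<sigma> j"
        using surj by (auto simp: F_def)
      with ij have "(inv \<sigma> i, inv \<sigma> j) \<in> F t f"
        using step[of "inv \<sigma> i" "inv \<sigma> j" e] by (auto simp: F_def surj)
      then show "(i, j) \<in> map_prod \<sigma> \<sigma> ` F t f"
        by (force simp: surj)
    qed
  qed
  have "sum (?s (\<sigma> v)) (F t' (\<sigma> f)) = sum (?s v) (F t f)"
    unfolding F[symmetric] using inj
    by (subst sum.reindex) (auto intro!: sum.cong inj_on_subset[OF prod.inj_map] simp: inj_eq)
  then show "arcs (edge_solution \<Gamma> e :: _ \<Rightarrow> _ \<Rightarrow> 'n) t f v = arcs (edge_solution \<Gamma> e) t' (\<sigma> f) (\<sigma> v)"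
    using \<open>v \<noteq> f\<close> inj by (simp add: arcs inj_eq)
qed

section \<open>Combinatorial Gauss--Bonnet\<close>

text \<open>This is the number of intersections of \<open>x\<close> with the edge: all disks of the
  tetrahedron meet it except the triangles at the other two vertices and the quadrilaterals disjoint
  from it.\<close>

definition edge_weight :: "('k \<Rightarrow> normal_disk \<Rightarrow> real) \<Rightarrow> 'k \<Rightarrow> 4 \<Rightarrow> 4 \<Rightarrow> real" where
  "edge_weight x t i j = x t (Tri i) + x t (Tri j) + (\<Sum>q\<in>UNIV. x t (Quad q)) - x t (Quad (pair_type i j))"

text \<open>Face \<open>f\<close> contains the edge, and a disk crossing the edge leaves an arc in
  this face that cuts off one of the end points. Hence the weight can be read off in a single
  face.\<close>

lemma edge_weight_arcs:
  assumes "i \<noteq> j" "f \<noteq> i" "f \<noteq> j"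
  shows "edge_weight x t i j = arcs x t f i + arcs x t f j"
proof -
  note p = pair_types_at_vertex[OF assms]
  have "(\<Sum>q\<in>UNIV. x t (Quad q)) = (\<Sum>q\<in>{pair_type i j, pair_type f i, pair_type f j}. x t (Quad q))"
    using p(1) by simp
  then show ?thesis
    using p(2-4) by (simp add: edge_weight_def arcs_def)
qed

lemma edge_weight_class:
  assumes "face_gluing \<Gamma>" "compatible \<Gamma> x" "i \<noteq> j" "(t', i', j') \<in> edge_class \<Gamma> (t, i, j)"
  shows "edge_weight x t' i' j' = edge_weight x t i j"
proof -
  \<comment> \<open>The value 0 for \<open>i = j\<close> is a default, since
    \<open>edge_class_invariant\<close> also asks about degenerate triples.\<close>
  let ?P = "\<lambda>(t, i, j). if i = j then 0 else edge_weight x t i j"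
  have "?P (t', i', j') = ?P (t, i, j)"
  proof (rule edge_class_invariant[OF assms(4)])
    fix t f t' \<sigma> i j assume \<Gamma>: "\<Gamma> t f = (t', \<sigma>)" and f: "f \<noteq> i" "f \<noteq> j"
    have inj: "inj \<sigma>" using face_gluingD(1)[OF assms(1) \<Gamma>] by (rule bij_is_inj)
    then show "?P (t, i, j) = ?P (t', \<sigma> i, \<sigma> j)"
      using edge_weight_arcs[of i j f x t] edge_weight_arcs[of "\<sigma> i" "\<sigma> j" "\<sigma> f" x t'] f
        compatibleD[OF assms(2) \<Gamma>, of i] compatibleD[OF assms(2) \<Gamma>, of j]
      by (auto simp: inj_eq)
  qed
  moreover have "i' \<noteq> j'"
    using edge_class_edges[OF assms(1) _ assms(4)] assms(3) by auto
  ultimately show ?thesis using assms(3) by simp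
qed

text \<open>A triangle meets one edge of each pair, a quadrilateral both edges of the two pairs
  other than its own; each edge counts with both orientations.\<close>

lemma sum_edge_weight:
  fixes d :: "3 \<Rightarrow> real"
  shows "(\<Sum>(i, j)\<in>{(i, j). i \<noteq> j}. edge_weight x t i j * d (pair_type i j)) =
    (2 * (\<Sum>v\<in>UNIV. x t (Tri v)) + 4 * (\<Sum>q\<in>UNIV. x t (Quad q))) * (\<Sum>q\<in>UNIV. d q)
      - 4 * (\<Sum>q\<in>UNIV. x t (Quad q) * d q)"
proof -
  have "(\<Sum>(i, j)\<in>{(i, j). i \<noteq> j}. edge_weight x t i j * d (pair_type i j)) =
      (\<Sum>(i, j)\<in>UNIV. if i = j then 0 else edge_weight x t i j * d (pair_type i j))"
    by (intro sum.mono_neutral_cong_left) auto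
  also have "\<dots> = (\<Sum>i\<in>UNIV. \<Sum>j\<in>UNIV. if i = j then 0 else edge_weight x t i j * d (pair_type i j))"
    by (simp add: sum.cartesian_product flip: UNIV_Times_UNIV)
  also have "\<dots> = (2 * (\<Sum>v\<in>UNIV. x t (Tri v)) + 4 * (\<Sum>q\<in>UNIV. x t (Quad q))) * (\<Sum>q\<in>UNIV. d q)
      - 4 * (\<Sum>q\<in>UNIV. x t (Quad q) * d q)"
    unfolding UNIV_tetrahedron UNIV_pairs edge_weight_def
    by (simp add: pair_type_def doubleton_eq_iff) algebra
  finally show ?thesis .
qed

definition tangential :: "'k::finite face_pairing \<Rightarrow> 'k angles \<Rightarrow> bool" where
  "tangential \<Gamma> \<delta> \<longleftrightarrow> (\<forall>t. (\<Sum>q\<in>UNIV. \<delta> $ t $ q) = 0) \<and>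
     (\<forall>e\<in>edges. (\<Sum>(t, i, j)\<in>edge_class \<Gamma> e. \<delta> $ t $ pair_type i j) = 0)"

lemma angle_data_add:
  assumes "angle_data \<Gamma> \<theta>"
  shows "angle_data \<Gamma> (\<theta> + \<delta>) \<longleftrightarrow> tangential \<Gamma> \<delta>"
proof -
  have "edge_angle_sum \<Gamma> (\<theta> + \<delta>) t i j =
      edge_angle_sum \<Gamma> \<theta> t i j + (\<Sum>(t, i, j)\<in>edge_class \<Gamma> (t, i, j). \<delta> $ t $ pair_type i j)" for t i j
    by (simp add: edge_angle_sum_def edge_class_def sum.distrib case_prod_unfold)
  then show ?thesis
    using assms by (auto simp: angle_data_def tangential_def sum.distrib)
qed

text \<open>The sum of the corner angles of all disks of \<open>x\<close> vanishes: around an edge class all tetrahedron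
  edges meet \<open>x\<close> equally often. A triangle contributes \<open>0\<close>, and a quadrilateral minus twice the
  value of \<open>\<delta>\<close> at the edges it separates.\<close>

lemma compatible_tangential:
  fixes x :: "'k::finite \<Rightarrow> normal_disk \<Rightarrow> real"
  assumes "face_gluing \<Gamma>" "compatible \<Gamma> x" "tangential \<Gamma> \<delta>"
  shows "(\<Sum>t\<in>UNIV. \<Sum>q\<in>UNIV. x t (Quad q) * \<delta> $ t $ q) = 0"
proof -
  have "(\<Sum>(t, i, j)\<in>c. edge_weight x t i j * \<delta> $ t $ pair_type i j) = 0"
    if c_class: "c \<in> edge_class \<Gamma> ` edges" for c
  proof -
    obtain t i j where c: "c = edge_class \<Gamma> (t, i, j)" and "i \<noteq> j"
      using c_class by auto
    have "(\<Sum>(s, k, l)\<in>c. edge_weight x s k l * \<delta> $ s $ pair_type k l) =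
        (\<Sum>(s, k, l)\<in>c. edge_weight x t i j * \<delta> $ s $ pair_type k l)"
      unfolding c
    proof (rule sum.cong[OF refl])
      fix e assume "e \<in> edge_class \<Gamma> (t, i, j)"
      then show "(case e of (s, k, l) \<Rightarrow> edge_weight x s k l * \<delta> $ s $ pair_type k l) =
          (case e of (s, k, l) \<Rightarrow> edge_weight x t i j * \<delta> $ s $ pair_type k l)"
        using edge_weight_class[OF assms(1,2) \<open>i \<noteq> j\<close>] by (cases e) auto
    qed
    also have "\<dots> = edge_weight x t i j * (\<Sum>(s, k, l)\<in>c. \<delta> $ s $ pair_type k l)"
      by (simp add: sum_distrib_left case_prod_unfold)
    also have "(\<Sum>(s, k, l)\<in>c. \<delta> $ s $ pair_type k l) = 0"
      using assms(3) \<open>i \<noteq> j\<close> unfolding tangential_def c by blast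
    finally show ?thesis by simp
  qed
  then have "(\<Sum>(t, i, j)\<in>edges. edge_weight x t i j * \<delta> $ t $ pair_type i j) = 0"
    by (subst sum_edge_classes[OF assms(1)]) (rule sum.neutral, blast)
  \<comment> \<open>The values of \<open>\<delta>\<close> sum to 0 in each tetrahedron, which kills
    the first term of \<open>sum_edge_weight\<close>.\<close>
  then have "(\<Sum>t\<in>UNIV. - 4 * (\<Sum>q\<in>UNIV. x t (Quad q) * \<delta> $ t $ q)) = 0"
    using assms(3) by (simp add: sum_edges_tetrahedra sum_edge_weight tangential_def)
  then show ?thesis
    by (simp add: sum_negf flip: sum_distrib_left)
qed

section \<open>Existence of angle structures\<close>

lemma compatible_sum:
  fixes X :: "'b \<Rightarrow> 'k \<Rightarrow> normal_disk \<Rightarrow> 'n::comm_ring_1"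
  assumes "\<And>b. b \<in> B \<Longrightarrow> compatible \<Gamma> (X b)"
  shows "compatible \<Gamma> (\<lambda>t \<delta>. \<Sum>b\<in>B. X b t \<delta> * y b)"
  unfolding compatible_def
proof (intro allI impI, elim conjE)
  fix t f v t' \<sigma> assume \<Gamma>: "\<Gamma> t f = (t', \<sigma>)" and "v \<noteq> f"
  have arcs: "arcs (\<lambda>t \<delta>. \<Sum>b\<in>B. X b t \<delta> * y b) t f v = (\<Sum>b\<in>B. arcs (X b) t f v * y b)" for t f v
    by (simp add: arcs_def sum.distrib distrib_right)
  show "arcs (\<lambda>t \<delta>. \<Sum>b\<in>B. X b t \<delta> * y b) t f v = arcs (\<lambda>t \<delta>. \<Sum>b\<in>B. X b t \<delta> * y b) t' (\<sigma> f) (\<sigma> v)"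
    unfolding arcs using compatibleD[OF assms \<Gamma> \<open>v \<noteq> f\<close>] by (intro sum.cong) simp_all
qed

text \<open>Adding copies of the vertex links makes the triangle coordinates non-negative.\<close>

lemma compatible_nat_solution:
  fixes X :: "'k::finite \<Rightarrow> normal_disk \<Rightarrow> rat"
  assumes "compatible \<Gamma> X" "\<And>t q. 0 \<le> X t (Quad q)"
  obtains x :: "'k \<Rightarrow> normal_disk \<Rightarrow> nat"
  where "compatible \<Gamma> x" "\<forall>t q. 0 < x t (Quad q) \<longleftrightarrow> 0 < X t (Quad q)"
proof -
  define A where "A = case_prod X ` (UNIV \<times> UNIV)"
  have "finite (UNIV :: ('k \<times> normal_disk) set)"
    by (simp add: finite_prod)
  then have "finite A" by (simp add: A_def)
  then obtain N :: nat where N: "0 < N" "\<forall>a\<in>A. of_nat N * a \<in> \<int>"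
    using common_denominator by blast
  obtain M :: nat where M: "Max ((\<lambda>a. - (of_nat N * a)) ` A) < of_nat M"
    using reals_Archimedean2 by blast
  have M: "0 \<le> of_nat N * a + of_nat M" if "a \<in> A" for a
  proof -
    have "- (of_nat N * a) \<le> Max ((\<lambda>a. - (of_nat N * a)) ` A)"
      using that \<open>finite A\<close> by (intro Max_ge) auto
    with M show ?thesis by linarith
  qed
  have A: "X t \<delta> \<in> A" for t \<delta> by (auto simp: A_def)
  \<comment> \<open>Every arc type lies on exactly one triangle type, so shifting the triangles by
    \<open>M\<close> raises all arc counts by \<open>M\<close> and leaves vanishing quadrilateral
    coordinates at 0.\<close>
  define m :: "normal_disk \<Rightarrow> nat" where "m = case_normal_disk (\<lambda>_. M) (\<lambda>_. 0)"
  define x where "x t \<delta> = nat \<lfloor>of_nat N * X t \<delta> + of_nat (m \<delta>)\<rfloor>" for t \<delta>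
  have x: "rat_of_nat (x t \<delta>) = of_nat N * X t \<delta> + of_nat (m \<delta>)" for t \<delta>
  proof -
    have "0 \<le> of_nat N * X t \<delta> + of_nat (m \<delta>)"
      using M[OF A[of t \<delta>]] assms(2) by (cases \<delta>) (auto simp: m_def)
    moreover have "of_nat N * X t \<delta> + of_nat (m \<delta>) \<in> \<int>"
      using N A[of t \<delta>] by simp
    ultimately obtain z where "of_nat N * X t \<delta> + of_nat (m \<delta>) = of_int z" "0 \<le> z"
      by (metis Ints_cases of_int_0_le_iff)
    then show ?thesis
      unfolding x_def by simp
  qed
  have arcs: "rat_of_nat (arcs x t f v) = of_nat N * arcs X t f v + of_nat M" for t f v
    by (simp add: arcs_def x m_def algebra_simps)
  show thesis
  proof
    have "rat_of_nat (arcs x t f v) = rat_of_nat (arcs x t' (\<sigma> f) (\<sigma> v))"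
      if "\<Gamma> t f = (t', \<sigma>)" "v \<noteq> f" for t f v t' \<sigma>
      using compatibleD[OF assms(1) that] by (simp add: arcs)
    then show "compatible \<Gamma> x"
      unfolding compatible_def by (metis of_nat_eq_iff)
    show "\<forall>t q. 0 < x t (Quad q) \<longleftrightarrow> 0 < X t (Quad q)"
    proof (intro allI)
      fix t q
      have "0 < x t (Quad q) \<longleftrightarrow> 0 < rat_of_nat (x t (Quad q))" by simp
      also have "\<dots> \<longleftrightarrow> 0 < X t (Quad q)"
        unfolding x using N by (simp add: m_def zero_less_mult_iff)
      finally show "0 < x t (Quad q) \<longleftrightarrow> 0 < X t (Quad q)" .
    qed
  qed
qed

text \<open>Stiemke is used with quadrilateral types as rows and the tetrahedral and edge solutions
  as columns. A violation would combine the columns to a solution excluded by \<open>no\<close>; the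
  positive vector obtained instead is orthogonal to all columns, which is what tangential
  means.\<close>

lemma ex_tangential_pos:
  fixes \<Gamma> :: "'k::finite face_pairing" and P :: "('k \<times> 3) set"
  assumes "face_gluing \<Gamma>"
    and no: "\<And>x. compatible \<Gamma> x \<Longrightarrow> (\<And>t q. 0 < x t (Quad q) \<Longrightarrow> (t, q) \<in> P) \<Longrightarrow>
        (\<And>t q. x t (Quad q) = (0::nat))"
  obtains \<delta> where "tangential \<Gamma> \<delta>" "\<And>t q. (t, q) \<in> P \<Longrightarrow> 0 < \<delta> $ t $ q"
proof -
  define G :: "'k + 'k \<times> 4 \<times> 4 \<Rightarrow> 'k \<Rightarrow> normal_disk \<Rightarrow> rat"
    where "G = case_sum tet_solution (edge_solution \<Gamma>)"
  define B :: "('k + 'k \<times> 4 \<times> 4) set" where "B = UNIV <+> edges"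
  have G: "compatible \<Gamma> (G b)" if "b \<in> B" for b
    using that compatible_tet_solution[of \<Gamma>] compatible_edge_solution[OF assms(1)]
    by (auto simp: B_def G_def)
  have "\<exists>d. (\<forall>b\<in>B. (\<Sum>i\<in>UNIV. d i * (\<lambda>(t, q) b. G b t (Quad q)) i b) = 0) \<and> (\<forall>i\<in>P. 0 < d i)"
  proof (rule stiemke)
    fix y p
    assume pos: "\<And>i. i \<in> UNIV \<Longrightarrow> 0 \<le> (\<Sum>b\<in>B. (\<lambda>(t, q) b. G b t (Quad q)) i b * y b)"
      and zero: "\<And>i. i \<in> UNIV - P \<Longrightarrow> (\<Sum>b\<in>B. (\<lambda>(t, q) b. G b t (Quad q)) i b * y b) = 0"
      and "p \<in> P"
    define X where "X = (\<lambda>t \<delta>. \<Sum>b\<in>B. G b t \<delta> * y b)"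
    have X: "(\<Sum>b\<in>B. (\<lambda>(t, q) b. G b t (Quad q)) i b * y b) = X (fst i) (Quad (snd i))" for i
      by (simp add: X_def case_prod_unfold)
    have "compatible \<Gamma> X"
      unfolding X_def by (rule compatible_sum) (rule G)
    moreover have "0 \<le> X t (Quad q)" for t q
      using pos[of "(t, q)"] unfolding X by simp
    ultimately obtain x :: "'k \<Rightarrow> normal_disk \<Rightarrow> nat"
      where x: "compatible \<Gamma> x" "\<forall>t q. 0 < x t (Quad q) \<longleftrightarrow> 0 < X t (Quad q)"
      by (rule compatible_nat_solution)
    have "X t (Quad q) = 0" if "(t, q) \<notin> P" for t q
      using zero[of "(t, q)"] that unfolding X by simp
    then have "x t (Quad q) = 0" for t q
      using x no[of x t q] by force
    then show "(\<Sum>b\<in>B. (\<lambda>(t, q) b. G b t (Quad q)) p b * y b) \<le> 0"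
      unfolding X using x(2) by (metis not_less less_irrefl)
  qed (simp_all add: B_def)
  then obtain d where d: "\<And>b. b \<in> B \<Longrightarrow> (\<Sum>i\<in>UNIV. d i * G b (fst i) (Quad (snd i))) = 0"
    and d_pos: "\<And>i. i \<in> P \<Longrightarrow> 0 < d i"
    by (auto simp: case_prod_unfold)
  define \<delta> :: "'k angles" where "\<delta> = (\<chi> t q. of_rat (d (t, q)))"
  have "(\<Sum>q\<in>UNIV. d (t, q)) = 0" for t
  proof -
    have "(\<Sum>i\<in>UNIV. d i * of_bool (t = fst i)) = 0"
      using d[of "Inl t"] by (simp add: B_def G_def InlI)
    also have "(\<Sum>i\<in>UNIV. d i * of_bool (t = fst i)) = (\<Sum>i\<in>{t} \<times> UNIV. d i)"
      by (rule sum.mono_neutral_cong_right) auto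
    also have "\<dots> = (\<Sum>q\<in>UNIV. d (t, q))"
      by (subst sum.cartesian_product[of "\<lambda>s q. d (s, q)", simplified, symmetric]) simp
    finally show ?thesis .
  qed
  then have tet: "(\<Sum>q\<in>UNIV. \<delta> $ t $ q) = 0" for t
    by (simp add: \<delta>_def flip: of_rat_sum)
  have "(\<Sum>(t, i, j)\<in>edge_class \<Gamma> e. d (t, pair_type i j)) = 0" if "e \<in> edges" for e
  proof -
    have "0 = (\<Sum>i\<in>UNIV. d i * G (Inr e) (fst i) (Quad (snd i)))"
      using d[of "Inr e"] that by (simp add: B_def InrI)
    \<comment> \<open>Each member of the class selects exactly one quadrilateral type, so exchanging
      the sums collects \<open>d\<close> along the class.\<close>
    also have "\<dots> = (\<Sum>i\<in>UNIV. \<Sum>e'\<in>edge_class \<Gamma> e.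
        if i = (fst e', pair_type (fst (snd e')) (snd (snd e'))) then d i else 0)"
      unfolding G_def sum.case edge_solution.simps sum_distrib_left case_prod_unfold
      by (intro sum.cong refl) (auto simp: prod_eq_iff)
    also have "\<dots> = (\<Sum>e'\<in>edge_class \<Gamma> e. d (fst e', pair_type (fst (snd e')) (snd (snd e'))))"
      by (subst sum.swap) simp
    finally show ?thesis by (simp add: case_prod_unfold)
  qed
  then have "(\<Sum>(t, i, j)\<in>edge_class \<Gamma> e. \<delta> $ t $ pair_type i j) = 0" if "e \<in> edges" for e
    using that by (simp add: \<delta>_def case_prod_unfold flip: of_rat_sum)
  with tet have "tangential \<Gamma> \<delta>"
    by (simp add: tangential_def)
  moreover have "0 < \<delta> $ t $ q" if "(t, q) \<in> P" for t q
    using d_pos[OF that] by (simp add: \<delta>_def)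
  ultimately show thesis using that by blast
qed

lemma ex_angle_structure:
  fixes \<Gamma> :: "'k::finite face_pairing"
  assumes "face_gluing \<Gamma>" "semi_angle_structure \<Gamma> \<theta>"
    and no: "\<And>x. compatible \<Gamma> x \<Longrightarrow> (\<And>t q. 0 < x t (Quad q) \<Longrightarrow> \<theta> $ t $ q = 0) \<Longrightarrow>
        (\<And>t q. x t (Quad q) = (0::nat))"
  shows "angle_structure_space \<Gamma> \<noteq> {}"
proof -
  obtain \<delta> where \<delta>: "tangential \<Gamma> \<delta>" "\<And>t q. \<theta> $ t $ q = 0 \<Longrightarrow> 0 < \<delta> $ t $ q"
    using ex_tangential_pos[OF assms(1), of "{(t, q). \<theta> $ t $ q = 0}"] no by auto
  have \<theta>: "angle_data \<Gamma> \<theta>" "\<And>t q. 0 \<le> \<theta> $ t $ q"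
    using assms(2) by (auto simp: semi_angle_structure_def)
  have "\<forall>\<^sub>F r in at_right 0. 0 < \<theta> $ t $ q + r * \<delta> $ t $ q" for t q
  \<comment> \<open>A vanishing angle becomes positive for every \<open>r > 0\<close>; a positive
    one stays positive for small \<open>r\<close> by continuity.\<close>
  proof (cases "\<theta> $ t $ q = 0")
    case True
    then show ?thesis
      using \<delta>(2)[OF True] eventually_at_right_less[of "0::real"] by (auto elim: eventually_mono)
  next
    case False
    have "((\<lambda>r. \<theta> $ t $ q + r * \<delta> $ t $ q) \<longlongrightarrow> \<theta> $ t $ q + 0 * \<delta> $ t $ q) (at_right 0)"
      by (intro tendsto_intros)
    then show ?thesis
      using False \<theta>(2)[of t q] by (intro order_tendstoD) auto
  qed
  then have "\<forall>\<^sub>F r in at_right 0. \<forall>t q. 0 < \<theta> $ t $ q + r * \<delta> $ t $ q"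
    by (intro eventually_all_finite)
  then obtain r where "\<forall>t q. 0 < \<theta> $ t $ q + r * \<delta> $ t $ q"
    using eventually_happens'[OF trivial_limit_at_right_real] by blast
  then have r: "\<And>t q. 0 < \<theta> $ t $ q + r * \<delta> $ t $ q"
    by blast
  have "tangential \<Gamma> (r *\<^sub>R \<delta>)"
    using \<delta>(1) by (simp add: tangential_def case_prod_unfold flip: sum_distrib_left)
  then have "angle_structure \<Gamma> (\<theta> + r *\<^sub>R \<delta>)"
    using r angle_data_add[OF \<theta>(1)] by (simp add: angle_structure_def)
  then show ?thesis
    by (auto simp: angle_structure_space_def)
qed

section \<open>The dimension of the space of angle structures\<close>

text \<open>Each fibre of \<open>f\<close> contains, with \<open>x\<close>, the different point
  \<open>r x\<close>. Here \<open>r\<close> will be reversal of orientation on edge classes.\<close>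

lemma double_card_image_le:
  assumes "finite S" "\<And>x. x \<in> S \<Longrightarrow> r x \<in> S \<and> r x \<noteq> x \<and> f (r x) = f x"
  shows "2 * card (f ` S) \<le> card S"
proof -
  have "2 \<le> card {x \<in> S. f x = y}" if y: "y \<in> f ` S" for y
  proof -
    obtain x where x: "x \<in> S" "y = f x" using y by blast
    have "{x, r x} \<subseteq> {x \<in> S. f x = y}"
      using assms(2)[OF x(1)] x by simp
    then have "card {x, r x} \<le> card {x \<in> S. f x = y}"
      using assms(1) by (intro card_mono) simp_all
    moreover have "card {x, r x} = 2"
      using assms(2)[OF x(1)] by (metis card_2_iff)
    ultimately show ?thesis by simp
  qed
  then have "(\<Sum>y\<in>f ` S. 2) \<le> (\<Sum>y\<in>f ` S. card {x \<in> S. f x = y})"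
    by (rule sum_mono)
  also have "\<dots> = card S"
    using sum.image_gen[OF assms(1), of "\<lambda>_. 1::nat" f] by simp
  finally show ?thesis by simp
qed

lemma edge_class_reverse:
  assumes "(t', i', j') \<in> edge_class \<Gamma> (t, i, j)"
  shows "(t', j', i') \<in> edge_class \<Gamma> (t, j, i)"
proof -
  have "(case (t', i', j') of (t', i', j') \<Rightarrow> (t', j', i') \<in> edge_class \<Gamma> (t, j, i)) =
      (case (t, i, j) of (t', i', j') \<Rightarrow> (t', j', i') \<in> edge_class \<Gamma> (t, j, i))"
    by (rule edge_class_invariant[OF assms]) (simp add: edge_class_step)
  then show ?thesis by (simp add: edge_class_refl)
qed

definition edge_normal :: "('k::finite \<times> 4 \<times> 4) set \<Rightarrow> 'k angles" where
  "edge_normal c = (\<Sum>(t, i, j)\<in>c. axis t (axis (pair_type i j) 1))"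

lemma inner_edge_normal: "edge_normal c \<bullet> \<theta> = (\<Sum>(t, i, j)\<in>c. \<theta> $ t $ pair_type i j)"
  by (simp add: edge_normal_def inner_sum_left case_prod_unfold inner_axis')

text \<open>The double count of all dihedral angles replaces the Euler characteristic argument for
  the number of edges: each of the two orientations of an edge has a class.\<close>

lemma card_edge_normals:
  fixes \<Gamma> :: "'k::finite face_pairing"
  assumes "face_gluing \<Gamma>" "angle_data \<Gamma> \<theta>"
  shows "card (edge_normal ` edge_class \<Gamma> ` edges) \<le> CARD('k)"
proof -
  let ?C = "edge_class \<Gamma> ` edges"
  have "2 * pi * card ?C = (\<Sum>c\<in>?C. \<Sum>(t, i, j)\<in>c. \<theta> $ t $ pair_type i j)"
  proof -
    have "(\<Sum>(t, i, j)\<in>c. \<theta> $ t $ pair_type i j) = 2 * pi" if "c \<in> ?C" for c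
      using that assms(2) by (auto simp: angle_data_def edge_angle_sum_def edge_class_def)
    then show ?thesis by simp
  qed
  also have "\<dots> = (\<Sum>(t, i, j)\<in>edges. \<theta> $ t $ pair_type i j)"
    by (rule sum_edge_classes[OF assms(1), symmetric])
  \<comment> \<open>Each angle sits at two edges with two orientations each, so a tetrahedron
    contributes \<open>4 * pi\<close>.\<close>
  also have "\<dots> = 2 * pi * (2 * CARD('k))"
    using assms(2) by (simp add: sum_edges_tetrahedra sum_pair_type angle_data_def)
  finally have card: "card ?C = 2 * CARD('k)"
    by (metis mult_cancel_left of_nat_eq_iff pi_neq_zero mult_eq_0_iff zero_neq_numeral)
  define flip :: "'k \<times> 4 \<times> 4 \<Rightarrow> 'k \<times> 4 \<times> 4" where "flip = (\<lambda>(t, i, j). (t, j, i))"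
  have flip: "flip e' \<in> edge_class \<Gamma> (flip e)" if "e' \<in> edge_class \<Gamma> e" for e e'
    using edge_class_reverse[of "fst e'" "fst (snd e')" "snd (snd e')" \<Gamma> "fst e" "fst (snd e)" "snd (snd e)"] that
    by (simp add: flip_def split_beta)
  have [simp]: "flip (flip e) = e" for e
    by (simp add: flip_def split_beta)
  have flip_class: "flip ` edge_class \<Gamma> e = edge_class \<Gamma> (flip e)" for e
  proof
    show "flip ` edge_class \<Gamma> e \<subseteq> edge_class \<Gamma> (flip e)"
      by (rule image_subsetI) (rule flip)
    show "edge_class \<Gamma> (flip e) \<subseteq> flip ` edge_class \<Gamma> e"
    proof
      fix e' assume "e' \<in> edge_class \<Gamma> (flip e)"
      then have "flip e' \<in> edge_class \<Gamma> e"
        using flip[of e' "flip e"] by simp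
      then show "e' \<in> flip ` edge_class \<Gamma> e"
        using imageI[of "flip e'" _ flip] by simp
    qed
  qed
  \<comment> \<open>Reversal fixes no class, because \<open>face_gluing\<close> forbids gluing an
    edge to its reverse, but it keeps the normal.\<close>
  have "2 * card (edge_normal ` ?C) \<le> card ?C"
  proof (rule double_card_image_le)
    fix c assume "c \<in> ?C"
    then obtain t i j where c: "c = edge_class \<Gamma> (t, i, j)" "i \<noteq> j" by auto
    have "inj flip" by (auto simp: flip_def inj_on_def)
    then have "edge_normal (flip ` c) = edge_normal c"
      unfolding edge_normal_def
      by (subst sum.reindex)
        (auto intro!: sum.cong simp: flip_def pair_type_commute intro: inj_on_subset[OF _ subset_UNIV])
    moreover have rc: "flip ` c = edge_class \<Gamma> (t, j, i)"
      using flip_class[of "(t, i, j)"] by (simp add: c flip_def)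
    moreover have "(t, j, i) \<notin> c"
      using assms(1) c by (simp add: face_gluing_def edge_class_def)
    ultimately show "flip ` c \<in> ?C \<and> flip ` c \<noteq> c \<and> edge_normal (flip ` c) = edge_normal c"
      using c(2) edge_class_refl[of "(t, j, i)" \<Gamma>] by auto
  qed simp
  with card show ?thesis by simp
qed

section \<open>Linear algebra of the angle equations\<close>

definition tet_normal :: "'k::finite \<Rightarrow> 'k angles" where
  "tet_normal t = (\<Sum>q\<in>UNIV. axis t (axis q 1))"

lemma inner_tet_normal: "tet_normal t \<bullet> \<theta> = (\<Sum>q\<in>UNIV. \<theta> $ t $ q)"
  by (simp add: tet_normal_def inner_sum_left inner_axis')

lemma aff_dim_angle_structure_space:
  fixes \<Gamma> :: "'k::finite face_pairing"
  assumes "face_gluing \<Gamma>" "angle_structure_space \<Gamma> \<noteq> {}"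
  shows "int CARD('k) \<le> aff_dim (angle_structure_space \<Gamma>)"
proof -
  obtain \<theta> where \<theta>: "angle_data \<Gamma> \<theta>" "\<And>t q. 0 < \<theta> $ t $ q"
    using assms(2) by (auto simp: angle_structure_space_def angle_structure_def)
  define C where "C = range tet_normal \<union> edge_normal ` edge_class \<Gamma> ` edges"
  define K where "K = {\<delta>. tangential \<Gamma> \<delta>}"
  have orth: "tangential \<Gamma> \<delta> \<longleftrightarrow> (\<forall>c\<in>C. orthogonal c \<delta>)" for \<delta>
    unfolding tangential_def C_def orthogonal_def
    by (simp add: ball_Un inner_tet_normal inner_edge_normal)
  have K: "K = {y \<in> UNIV. \<forall>c\<in>span C. orthogonal c y}"
    unfolding K_def orth by (auto simp: orthogonal_commute intro: orthogonal_to_span span_base)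
  have "card C \<le> card (range (tet_normal :: 'k \<Rightarrow> _)) + card (edge_normal ` edge_class \<Gamma> ` edges)"
    unfolding C_def by (rule card_Un_le)
  also have "\<dots> \<le> 2 * CARD('k)"
    using card_edge_normals[OF assms(1) \<theta>(1)] card_image_le[of UNIV "tet_normal :: 'k \<Rightarrow> _"] by simp
  finally have "dim C \<le> 2 * CARD('k)"
    using dim_le_card'[of C] by (simp add: C_def)
  moreover have "dim K + dim (span C) = 3 * CARD('k)"
    unfolding K using dim_subspace_orthogonal_to_vectors[of "span C" UNIV] by simp
  ultimately have "CARD('k) \<le> dim K"
    by simp
  have "subspace K"
    unfolding K by (auto simp: subspace_def orthogonal_def inner_add_right)
  define U :: "'k angles set" where "U = {\<theta>. \<forall>t q. 0 < \<theta> $ t $ q}"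
  have "open U"
    unfolding U_def Collect_all_eq by (intro open_INT ballI finite open_Collect_less continuous_intros)
  have space: "angle_structure_space \<Gamma> = (+) \<theta> ` K \<inter> U"
  proof -
    have "angle_structure \<Gamma> \<theta>' \<longleftrightarrow> tangential \<Gamma> (\<theta>' - \<theta>) \<and> \<theta>' \<in> U" for \<theta>'
      using angle_data_add[OF \<theta>(1), of "\<theta>' - \<theta>"] by (simp add: angle_structure_def U_def)
    then show ?thesis
      by (force simp: angle_structure_space_def K_def image_iff)
  qed
  \<comment> \<open>A non-empty part of a convex set cut out by an open set keeps the full affine
    dimension.\<close>
  have "aff_dim ((+) \<theta> ` K \<inter> U) = aff_dim ((+) \<theta> ` K)"
    using assms(2) \<open>subspace K\<close> \<open>open U\<close>
    by (intro aff_dim_convex_Int_open convex_translation subspace_imp_convex) (simp_all add: space)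
  then show ?thesis
    using \<open>CARD('k) \<le> dim K\<close> \<open>subspace K\<close> by (simp add: space aff_dim_translation_eq aff_dim_subspace)
qed

section \<open>The equivalence\<close>

text \<open>Gauss-Bonnet is applied to \<open>\<theta>' - \<theta>\<close>, which is positive
  wherever \<open>x\<close> has quadrilaterals. All terms of the vanishing sum are then
  non-negative, hence 0.\<close>

lemma no_quad_of_angle_structure:
  fixes \<Gamma> :: "'k::finite face_pairing"
  assumes "face_gluing \<Gamma>" "semi_angle_structure \<Gamma> \<theta>" "angle_structure \<Gamma> \<theta>'"
    and "compatible \<Gamma> x" "\<And>t q. 0 < x t (Quad q) \<Longrightarrow> \<theta> $ t $ q = 0"
  shows "x t (Quad q) = (0::nat)"
proof -
  have \<theta>: "angle_data \<Gamma> \<theta>" and \<theta>': "angle_data \<Gamma> \<theta>'" "\<And>t q. 0 < \<theta>' $ t $ q"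
    using assms(2,3) by (auto simp: semi_angle_structure_def angle_structure_def)
  have "compatible \<Gamma> (\<lambda>t \<delta>. real (x t \<delta>))"
    using assms(4) unfolding compatible_def arcs_def by (metis of_nat_add)
  moreover have "tangential \<Gamma> (\<theta>' - \<theta>)"
    using angle_data_add[OF \<theta>, of "\<theta>' - \<theta>"] \<theta>' by simp
  ultimately have "(\<Sum>t\<in>UNIV. \<Sum>q\<in>UNIV. real (x t (Quad q)) * (\<theta>' - \<theta>) $ t $ q) = 0"
    by (rule compatible_tangential[OF assms(1)])
  moreover have nonneg: "0 \<le> real (x t (Quad q)) * (\<theta>' - \<theta>) $ t $ q" for t q
    using assms(5)[of t q] \<theta>'(2)[of t q] by (cases "x t (Quad q) = 0") auto
  ultimately have "real (x t (Quad q)) * (\<theta>' - \<theta>) $ t $ q = 0"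
    by (simp add: sum_nonneg_eq_0_iff sum_nonneg)
  then show ?thesis
    using assms(5)[of t q] \<theta>'(2)[of t q] by (cases "x t (Quad q) = 0") auto
qed

theorem theorem3p1:
  fixes N :: "'a topology"
    and \<C> :: "'a chart set"
    and \<Gamma> :: "'k::finite face_pairing"
    and \<theta> :: "'k angles"
  assumes "smooth_3manifold_with_boundary N \<C>"
    and "compact_space N"
    and "\<forall>F\<in>boundary_components N \<C>.
           torus_or_klein_bottle (subtopology N F) \<and> incompressible N F"
    and "irreducible_interior N \<C>"
    and "P2_irreducible_interior N \<C>"
    and "atoroidal_interior N \<C>"
    and "ideal_triangulation \<Gamma> (int_space N \<C>)"
    and "taut_structure \<Gamma> \<theta> \<or> semi_angle_structure \<Gamma> \<theta>"
  shows "(angle_structure_space \<Gamma> \<noteq> {} \<and> int CARD('k) \<le> aff_dim (angle_structure_space \<Gamma>)) \<longleftrightarrow>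
         \<not> (\<exists>x. branched_normal_class \<Gamma> x \<and>
               (\<exists>t q. 0 < x t (Quad q) \<and> quad_angle_sum \<theta> t q = 2 * pi) \<and>
               \<not> (\<exists>t q. 0 < x t (Quad q) \<and> quad_angle_sum \<theta> t q < 2 * pi))"
proof -
  have \<Gamma>: "face_gluing \<Gamma>"
    using assms(7) by (simp add: ideal_triangulation_def)
  have "0 \<le> y" if "y \<in> {0, pi}" for y :: real
    using that by auto
  then have \<theta>: "semi_angle_structure \<Gamma> \<theta>"
    using assms(8) unfolding taut_structure_def semi_angle_structure_def by blast
  then have "angle_data \<Gamma> \<theta>" and nonneg: "\<And>t q. 0 \<le> \<theta> $ t $ q"
    by (simp_all add: semi_angle_structure_def)
  then have quad: "quad_angle_sum \<theta> t q = 2 * pi - 2 * \<theta> $ t $ q" for t q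
    by (simp add: quad_angle_sum_eq angle_data_def)
  have class_iff: "branched_normal_class \<Gamma> x \<longleftrightarrow> compatible \<Gamma> x" for x
    using \<Gamma> branched_normal_class_compatible compatible_branched_normal_class by blast
  \<comment> \<open>The dimension bound follows from non-emptiness, so it suffices to characterise
    non-emptiness.\<close>
  have "angle_structure_space \<Gamma> \<noteq> {} \<longleftrightarrow>
      (\<forall>x::'k normal_vector. compatible \<Gamma> x \<longrightarrow> (\<forall>t q. 0 < x t (Quad q) \<longrightarrow> \<theta> $ t $ q = 0) \<longrightarrow>
        (\<forall>t q. x t (Quad q) = 0))"
    using no_quad_of_angle_structure[OF \<Gamma> \<theta>] ex_angle_structure[OF \<Gamma> \<theta>]
    unfolding angle_structure_space_def by blast
  moreover have "quad_angle_sum \<theta> t q < 2 * pi \<longleftrightarrow> \<theta> $ t $ q \<noteq> 0"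
      "quad_angle_sum \<theta> t q = 2 * pi \<longleftrightarrow> \<theta> $ t $ q = 0" for t q
    using nonneg[of t q] by (auto simp: quad)
  ultimately show ?thesis
    using aff_dim_angle_structure_space[OF \<Gamma>] unfolding class_iff by (metis gr0I less_numeral_extra(3))
qed

end
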